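(* There is a function $\varepsilon:\mathbb{N}\to\mathbb{R}$ with $\varepsilon(d)\to 0$ as $d\to\infty$ such that for every integer $g\ge 3$ and every positive integer $d$ there exists a finite orthogonality graph $G$ in $\mathbb{S}^{d-1}$ with girth at least $g$ and $\chi(G)\ge (1.074+\varepsilon(d))^d$.
   Context: $\mathbb{S}^{d-1}\subseteq\mathbb{R}^d$ is the set of unit vectors. A graph $G$ is an orthogonality graph in a set $S\subseteq\mathbb{R}^d$ if there is an injective map from $V(G)$ to $S$ such that any two adjacent vertices are mapped to orthogonal vectors (non-adjacent vertices may also be mapped to orthogonal vectors). The girth of a graph is the length of its shortest cycle. $\chi(G)$ denotes the chromatic number. *)

theory Defs
  imports Complex_Main
begin

definition simple_graph :: "nat set \<Rightarrow> (nat \<times> nat) set \<Rightarrow> bool" where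
  "simple_graph V E \<longleftrightarrow> E \<subseteq> V \<times> V \<and> (\<forall>u v. (u, v) \<in> E \<longrightarrow> (v, u) \<in> E)
     \<and> (\<forall>v. (v, v) \<notin> E)"

text \<open>Vectors of R^d are functions nat \<Rightarrow> real vanishing at coordinates \<ge> d.\<close>

definition inner_d :: "nat \<Rightarrow> (nat \<Rightarrow> real) \<Rightarrow> (nat \<Rightarrow> real) \<Rightarrow> real" where
  "inner_d d x y = (\<Sum>i<d. x i * y i)"

definition unit_sphere :: "nat \<Rightarrow> (nat \<Rightarrow> real) set" where
  "unit_sphere d = {x. (\<forall>i\<ge>d. x i = 0) \<and> inner_d d x x = 1}"

definition orthogonality_graph_in ::
  "nat \<Rightarrow> (nat \<Rightarrow> real) set \<Rightarrow> nat set \<Rightarrow> (nat \<times> nat) set \<Rightarrow> bool" where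
  "orthogonality_graph_in d S V E \<longleftrightarrow>
     (\<exists>f. inj_on f V \<and> f ` V \<subseteq> S \<and> (\<forall>(u, v)\<in>E. inner_d d (f u) (f v) = 0))"

definition is_cycle :: "nat set \<Rightarrow> (nat \<times> nat) set \<Rightarrow> nat list \<Rightarrow> bool" where
  "is_cycle V E xs \<longleftrightarrow> length xs \<ge> 3 \<and> distinct xs \<and> set xs \<subseteq> V \<and>
     (\<forall>i<length xs. (xs ! i, xs ! ((i + 1) mod length xs)) \<in> E)"

text \<open>Girth at least g: every cycle has length at least g (acyclic graphs have infinite girth).\<close>

definition girth_at_least :: "nat \<Rightarrow> nat set \<Rightarrow> (nat \<times> nat) set \<Rightarrow> bool" where
  "girth_at_least g V E \<longleftrightarrow> (\<forall>xs. is_cycle V E xs \<longrightarrow> length xs \<ge> g)"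

definition proper_colouring :: "nat set \<Rightarrow> (nat \<times> nat) set \<Rightarrow> (nat \<Rightarrow> nat) \<Rightarrow> nat \<Rightarrow> bool" where
  "proper_colouring V E c k \<longleftrightarrow> c ` V \<subseteq> {..<k} \<and> (\<forall>(u, v)\<in>E. c u \<noteq> c v)"

definition chromatic_number :: "nat set \<Rightarrow> (nat \<times> nat) set \<Rightarrow> nat" where
  "chromatic_number V E = (LEAST k. \<exists>c. proper_colouring V E c k)"

end

theory Submission
  imports Defs "HOL-Library.FuncSet" "HOL-Computational_Algebra.Primes" "HOL-Real_Asymp.Real_Asymp"
begin

text \<open>
  Split \<open>2 * t\<close> of the coordinates into \<open>t\<close> planes and consider the words over the alphabet
  \<open>0, \<plusminus>e\<^sub>1, \<plusminus>e\<^sub>2\<close> with exactly \<open>p\<close> nonzero letters, \<open>p\<close> an odd prime. By the polynomial method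
  modulo \<open>p\<close> (Frankl and Wilson) a set of words without orthogonal pairs is exponentially small,
  even if only pairs with different supports are considered: a parity argument excludes the others.

  Rotating the \<open>t\<close> planes independently produces arbitrarily many copies of this graph. Words with
  different supports have different stabilisers in the torus of rotations, so fixing one endpoint of
  an edge leaves many positions for the other one. The union of the copies is therefore locally
  rich enough for a greedy choice of edges that keeps the girth large and destroys all colourings
  with few colours: the edges that would exceed the degree bound or close a short cycle are a small
  fraction of all edges, so averaging over the surviving colourings yields an edge which destroys
  a fixed proportion of them.

  The rate per plane exceeds \<open>1.074\<^sup>2\<close> for all \<open>p\<close> between \<open>0.31 * t\<close> and \<open>0.7 * t\<close>. As the ratio of
  these bounds is larger than 2, Chebyshev's estimates provide such a prime.
\<close>

section \<open>Primes in a multiplicative interval\<close>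

definition primorial :: "nat \<Rightarrow> nat" where
  "primorial n = \<Prod>{q. prime q \<and> q \<le> n}"

lemma prod_primes_dvd:
  fixes A :: "nat set"
  assumes "finite A" and "\<And>q. q \<in> A \<Longrightarrow> prime q" and "\<And>q. q \<in> A \<Longrightarrow> q dvd n"
  shows "\<Prod>A dvd n"
  using assms
proof (induction A rule: finite_induct)
  case (insert q A)
  have "coprime q (\<Prod>A)"
    using insert by (intro prod_coprime_right) (auto intro: primes_coprime)
  then show ?case
    using insert by (auto intro: divides_mult)
qed simp

lemma odd_binomial_middle_le: "(2 * m + 1) choose m \<le> 4 ^ m"
proof -
  have "((2 * m + 1) choose m) + ((2 * m + 1) choose (m + 1))
      = (\<Sum>k\<in>{m, m + 1}. (2 * m + 1) choose k)"
    by simp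
  also have "\<dots> \<le> (\<Sum>k\<le>2 * m + 1. (2 * m + 1) choose k)"
    by (rule sum_mono2) auto
  also have "\<dots> = 2 * 4 ^ m"
    unfolding choose_row_sum by (simp add: power_mult)
  finally show ?thesis
    using binomial_symmetric[of m "2 * m + 1"] by simp
qed

lemma prime_dvd_binomial:
  assumes q: "prime q" and "k < q" "n - k < q" "q \<le> n"
  shows "q dvd n choose k"
proof -
  have "fact k * fact (n - k) * (n choose k) = (fact n :: nat)"
    using assms by (intro binomial_fact_lemma) linarith
  moreover have "q dvd fact n" "\<not> q dvd fact k" "\<not> q dvd fact (n - k)"
    using assms by (simp_all add: prime_dvd_fact_iff del: fact_Suc)
  ultimately show ?thesis
    using q by (metis prime_dvd_mult_iff)
qed

lemma primorial_odd_le: "primorial (2 * m + 1) \<le> primorial (m + 1) * 4 ^ m"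
proof -
  define A where "A = {q::nat. prime q \<and> m + 1 < q \<and> q \<le> 2 * m + 1}"
  have "q dvd (2 * m + 1) choose m" if "q \<in> A" for q
    using that by (intro prime_dvd_binomial) (auto simp: A_def)
  then have "\<Prod>A dvd (2 * m + 1) choose m"
    by (intro prod_primes_dvd) (auto simp: A_def)
  then have "\<Prod>A \<le> (2 * m + 1) choose m"
    by (rule dvd_imp_le) simp
  also note odd_binomial_middle_le
  finally have "\<Prod>A \<le> 4 ^ m" .
  moreover have "primorial (2 * m + 1) = primorial (m + 1) * \<Prod>A"
  proof -
    have "{q. prime q \<and> q \<le> 2 * m + 1} = {q. prime q \<and> q \<le> m + 1} \<union> A"
      by (auto simp: A_def)
    then show ?thesis
      unfolding primorial_def by (simp only:) (rule prod.union_disjoint, auto simp: A_def)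
  qed
  ultimately show ?thesis by simp
qed

lemma primorial_le: "primorial n \<le> 4 ^ n"
proof (induction n rule: less_induct)
  case (less n)
  consider "n < 2" | "n = 2" | "n > 2" "even n" | "n > 2" "odd n" by linarith
  then show ?case
  proof cases
    case 1
    then have none: "{q::nat. prime q \<and> q \<le> n} = {}" by (auto dest: prime_ge_2_nat)
    show ?thesis unfolding primorial_def none by simp
  next
    case 2
    then have two: "{q::nat. prime q \<and> q \<le> n} = {2}" by (auto dest: prime_ge_2_nat)
    show ?thesis unfolding primorial_def two using 2 by simp
  next
    case 3
    have "\<not> prime n" using 3 prime_odd_nat by blast
    then have "{q. prime q \<and> q \<le> n} = {q. prime q \<and> q \<le> n - 1}"
      by (auto simp: le_eq_less_or_eq[of _ n])
    then have "primorial n = primorial (n - 1)" by (simp add: primorial_def)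
    also have "\<dots> \<le> 4 ^ (n - 1)" using 3 by (intro less) auto
    also have "\<dots> \<le> 4 ^ n" by (rule power_increasing) auto
    finally show ?thesis .
  next
    case 4
    then obtain m where m: "n = 2 * m + 1" by (auto elim: oddE)
    have "primorial n \<le> primorial (m + 1) * 4 ^ m" unfolding m by (rule primorial_odd_le)
    also have "\<dots> \<le> 4 ^ (m + 1) * 4 ^ m" using 4 m by (intro mult_right_mono less) auto
    also have "\<dots> = 4 ^ n" by (simp add: m flip: power_add)
    finally show ?thesis .
  qed
qed

text \<open>The hypothesis on \<open>c\<close> says that \<open>1 / c = 1 / a - 1 / b\<close>.\<close>

lemma dvd_if_reciprocal_difference:
  fixes a b c n :: "'a::idom"
  assumes "a dvd n" "b dvd n" and eq: "a * b = c * (b - a)" and nz: "a * b \<noteq> 0"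
  shows "c dvd n"
proof -
  obtain x y where x: "n = a * x" and y: "n = b * y" using assms(1,2) by (elim dvdE)
  have "(b - a) * n = b * (a * x) - a * (b * y)" by (simp add: left_diff_distrib flip: x y)
  also have "\<dots> = (a * b) * (x - y)" by (simp add: algebra_simps)
  also have "\<dots> = (b - a) * (c * (x - y))" by (simp add: eq ac_simps)
  finally have "n = c * (x - y)" using eq nz by auto
  then show ?thesis by simp
qed

text \<open>
  The induction follows the recursion of Leibniz' harmonic triangle, whose entries are the
  reciprocals of \<open>Suc n * (n choose k)\<close>.
\<close>

lemma Suc_times_binomial_dvd_Lcm:
  "k \<le> n \<Longrightarrow> Suc n * (n choose k) dvd Lcm {1..Suc n}"
proof (induction k arbitrary: n)
  case 0
  show ?case by (simp add: dvd_Lcm)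
next
  case (Suc k)
  then obtain n' where n: "n = Suc n'" and k: "k \<le> n'" by (cases n) auto
  define a b c where "a = Suc n' * (n' choose k)" and "b = Suc n * (n choose k)"
    and "c = Suc n * (n choose Suc k)"
  have "a dvd Lcm {1..Suc n'}" unfolding a_def by (rule Suc.IH[OF k])
  also have "\<dots> dvd Lcm {1..Suc n}" by (rule Lcm_subset) (auto simp: n)
  finally have a: "int a dvd int (Lcm {1..Suc n})" by (simp only: int_dvd_int_iff)
  have b: "int b dvd int (Lcm {1..Suc n})"
    unfolding b_def int_dvd_int_iff using k n by (intro Suc.IH) simp
  have a_eq: "Suc k * (n choose Suc k) = a"
    unfolding a_def n by (rule Suc_times_binomial)
  have "(n - k) * (n choose k) = a"
    using binomial_absorb_comp[of n k] by (simp add: a_def n)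
  moreover have "b = ((n - k) + Suc k) * (n choose k)"
    using k n by (simp add: b_def)
  ultimately have "b = a + Suc k * (n choose k)"
    by (simp only: add_mult_distrib)
  then have "int b - int a = int (Suc k * (n choose k))" by simp
  moreover have "a * b = c * (Suc k * (n choose k))"
    unfolding b_def c_def a_eq[symmetric] by (simp only: ac_simps)
  ultimately have "int a * int b = int c * (int b - int a)"
    by (simp only: of_nat_mult[symmetric])
  moreover have "int a * int b \<noteq> 0"
    using k n by (simp add: a_def b_def del: binomial_Suc_Suc of_nat_Suc mult_Suc)
  ultimately have "int c dvd int (Lcm {1..Suc n})"
    by (rule dvd_if_reciprocal_difference[OF a b])
  then show ?case by (simp only: c_def int_dvd_int_iff)
qed

lemma four_power_le_Lcm: "4 ^ m \<le> Lcm {1..2 * m + 1 :: nat}"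
proof -
  have "(4::nat) ^ m = (\<Sum>k\<le>2 * m. (2 * m) choose k)"
    by (simp add: choose_row_sum power_mult)
  also have "\<dots> \<le> (\<Sum>k\<le>2 * m. (2 * m) choose m)"
    by (intro sum_mono binomial_maximum')
  also have "\<dots> = Suc (2 * m) * ((2 * m) choose m)" by simp
  also have "\<dots> \<le> Lcm {1..2 * m + 1}"
    using Suc_times_binomial_dvd_Lcm[of m "2 * m"]
    by (intro dvd_imp_le) (simp_all add: Lcm_0_iff flip: neq0_conv)
  finally show ?thesis .
qed

lemma prime_power_dvd_lcm_iff:
  fixes a b q :: "'a::factorial_semiring_gcd"
  assumes "prime q"
  shows "q ^ e dvd lcm a b \<longleftrightarrow> q ^ e dvd a \<or> q ^ e dvd b"
proof (cases "a = 0 \<or> b = 0")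
  case False
  then have "multiplicity q (lcm a b) = max (multiplicity q a) (multiplicity q b)"
    using assms by (simp add: multiplicity_lcm)
  moreover have "\<not> is_unit q" using assms by auto
  ultimately show ?thesis
    using False by (simp add: power_dvd_iff_le_multiplicity lcm_eq_0_iff le_max_iff_disj)
qed auto

lemma prime_power_dvd_Lcm_iff:
  fixes q :: nat
  assumes "finite A" "A \<noteq> {}" "prime q"
  shows "q ^ e dvd Lcm A \<longleftrightarrow> (\<exists>a\<in>A. q ^ e dvd a)"
  using assms
  by (induction A rule: finite_ne_induct) (simp_all add: prime_power_dvd_lcm_iff)

lemma prime_power_le_if_dvd_Lcm:
  fixes n q :: nat
  assumes "prime q" "0 < n" "q ^ e dvd Lcm {1..n}"
  shows "q ^ e \<le> n"
proof -
  obtain a where "a \<in> {1..n}" "q ^ e dvd a"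
    using assms prime_power_dvd_Lcm_iff[of "{1..n}" q e] by auto
  then show ?thesis by (auto dest!: dvd_imp_le)
qed

lemma Lcm_eq_prod_prime_powers:
  fixes n :: nat
  assumes "0 < n"
  shows "Lcm {1..n} = (\<Prod>q | prime q \<and> q \<le> n. q ^ multiplicity q (Lcm {1..n}))"
proof -
  have "Lcm {1..n} \<noteq> 0" by (simp add: Lcm_0_iff)
  then have "Lcm {1..n} = (\<Prod>q\<in>prime_factors (Lcm {1..n}). q ^ multiplicity q (Lcm {1..n}))"
    by (simp add: prod_prime_factors)
  also have "\<dots> = (\<Prod>q | prime q \<and> q \<le> n. q ^ multiplicity q (Lcm {1..n}))"
  proof (rule prod.mono_neutral_left)
    show "prime_factors (Lcm {1..n}) \<subseteq> {q. prime q \<and> q \<le> n}"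
      using assms prime_power_le_if_dvd_Lcm[of _ n 1] by (auto simp: in_prime_factors_iff)
  qed (auto simp: prime_factors_multiplicity)
  finally show ?thesis .
qed

lemma Lcm_le_power_mult_primorial:
  assumes "0 < n" "n < r\<^sup>2"
  shows "Lcm {1..n} \<le> n ^ r * primorial n"
proof -
  define e where "e q = multiplicity q (Lcm {1..n})" for q
  define P where "P = {q. prime q \<and> q \<le> n}"
  have "finite P" by (simp add: P_def)
  have power_le: "q ^ e q \<le> n" if "prime q" for q
    using that assms multiplicity_dvd by (intro prime_power_le_if_dvd_Lcm) (auto simp: e_def)
  have power_le_self: "q ^ e q \<le> q" if "prime q" "r \<le> q" for q
  proof -
    have "q ^ e q \<le> n" using that by (intro power_le)
    also have "n < r\<^sup>2" by (rule assms)
    also have "\<dots> \<le> q\<^sup>2" using that by (intro power_mono) auto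
    finally have "e q < 2"
      using prime_gt_1_nat[OF that(1)] by (simp add: power_strict_increasing_iff)
    then show ?thesis
      using power_increasing[of "e q" 1 q] prime_ge_1_nat[OF that(1)] by simp
  qed
  have "Lcm {1..n} = (\<Prod>q\<in>P. q ^ e q)"
    unfolding P_def e_def using assms(1) by (rule Lcm_eq_prod_prime_powers)
  also have "\<dots> \<le> (\<Prod>q\<in>P. (if q < r then n else 1) * q)"
  proof (intro prod_mono conjI)
    fix q assume "q \<in> P"
    then have "prime q" "1 \<le> q" by (auto simp: P_def dest: prime_ge_1_nat)
    then show "q ^ e q \<le> (if q < r then n else 1) * q"
      using power_le power_le_self by (cases "q < r") (auto intro: order_trans[of _ n])
  qed simp
  also have "\<dots> = n ^ card (P \<inter> {q. q < r}) * primorial n"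
    using \<open>finite P\<close> by (simp add: prod.distrib prod.If_cases primorial_def P_def)
  also have "\<dots> \<le> n ^ r * primorial n"
    using card_mono[of "{..<r}" "P \<inter> {q. q < r}"] assms
    by (intro mult_right_mono power_increasing) auto
  finally show ?thesis .
qed

lemma exists_prime_between:
  fixes m n r :: nat
  assumes "2 * m + 1 < r\<^sup>2" "(2 * m + 1) ^ r * 4 ^ n < 4 ^ m"
  shows "\<exists>q. prime q \<and> n < q \<and> q \<le> 2 * m + 1"
proof (rule ccontr)
  assume none: "\<not> ?thesis"
  have "primorial (2 * m + 1) \<le> primorial n"
    unfolding primorial_def
  proof (rule dvd_imp_le)
    show "\<Prod>{q. prime q \<and> q \<le> 2 * m + 1} dvd \<Prod>{q. prime q \<and> q \<le> n}"
      using none by (intro prod_dvd_prod_subset) (auto simp: not_less)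
  qed (auto intro!: prod_pos simp: prime_gt_0_nat)
  have "4 ^ m \<le> Lcm {1..2 * m + 1}" by (rule four_power_le_Lcm)
  also have "\<dots> \<le> (2 * m + 1) ^ r * primorial (2 * m + 1)"
    using assms(1) by (intro Lcm_le_power_mult_primorial) auto
  also have "\<dots> \<le> (2 * m + 1) ^ r * 4 ^ n"
    using \<open>primorial (2 * m + 1) \<le> primorial n\<close> primorial_le[of n] by (intro mult_left_mono) auto
  finally show False using assms(2) by simp
qed

lemma exists_prime_between_real:
  fixes a b :: real
  assumes "0 \<le> a" "3 \<le> b" and big: "b powr (sqrt b + 1) * 4 powr (a + 1) < 4 powr (b / 2 - 3 / 2)"
  shows "\<exists>q. prime q \<and> a < real q \<and> real q \<le> b"
proof -
  define m n r where "m = nat \<lfloor>b / 2 - 1 / 2\<rfloor>" and "n = nat \<lceil>a\<rceil>" and "r = nat \<lfloor>sqrt b + 1\<rfloor>"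
  have m: "2 * real m + 1 \<le> b" "b / 2 - 3 / 2 \<le> real m"
    using assms unfolding m_def by linarith+
  have n: "a \<le> real n" "real n \<le> a + 1"
    using assms unfolding n_def by linarith+
  have "0 \<le> sqrt b" using assms by simp
  then have r: "sqrt b < real r" "real r \<le> sqrt b + 1"
    unfolding r_def by linarith+
  have "sqrt b ^ 2 < real r ^ 2"
    using r \<open>0 \<le> sqrt b\<close> by (intro power_strict_mono) auto
  then have "real (2 * m + 1) < real (r\<^sup>2)" using m assms by simp
  then have less: "2 * m + 1 < r\<^sup>2" by (simp only: of_nat_less_iff)
  have "real ((2 * m + 1) ^ r * 4 ^ n) = real (2 * m + 1) powr r * 4 powr n"
    by (simp only: of_nat_mult of_nat_power powr_realpow) (simp add: powr_realpow)
  also have "\<dots> \<le> b powr (sqrt b + 1) * 4 powr (a + 1)"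
    using m n r assms by (intro mult_mono order_trans[OF powr_mono2 powr_mono] powr_mono) auto
  also note big
  also have "4 powr (b / 2 - 3 / 2) \<le> 4 powr real m" using m by (intro powr_mono) auto
  also have "\<dots> = real (4 ^ m)" by (simp add: powr_realpow)
  finally have "(2 * m + 1) ^ r * 4 ^ n < 4 ^ m" by (simp only: of_nat_less_iff)
  from exists_prime_between[OF less this]
  obtain q where "prime q" "n < q" "q \<le> 2 * m + 1" by blast
  then show ?thesis using m(1) n(1) by (intro exI[of _ q]) auto
qed

lemma eventually_exists_prime_between:
  fixes \<alpha> \<beta> :: real
  assumes "0 < \<alpha>" "2 * \<alpha> < \<beta>"
  shows "\<forall>\<^sub>F t::nat in sequentially. \<exists>q. prime q \<and> \<alpha> * t < real q \<and> real q \<le> \<beta> * t"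
proof -
  have "\<forall>\<^sub>F t::nat in sequentially.
      (\<beta> * t) powr (sqrt (\<beta> * t) + 1) * 4 powr (\<alpha> * t + 1) < 4 powr (\<beta> * t / 2 - 3 / 2)"
    using assms by real_asymp
  moreover have "\<forall>\<^sub>F t::nat in sequentially. 3 \<le> \<beta> * t"
    using assms by real_asymp
  ultimately show ?thesis
    by eventually_elim (use assms in \<open>intro exists_prime_between_real; simp\<close>)
qed

section \<open>A rank bound modulo a prime\<close>

lemma exists_dependency_mod:
  fixes a :: "'i \<Rightarrow> 'j \<Rightarrow> int" and p :: nat
  assumes "finite I" "finite J" "card J < card I" "1 < p"
  shows "\<exists>c. (\<exists>i\<in>I. \<not> int p dvd c i) \<and> (\<forall>j\<in>J. int p dvd (\<Sum>i\<in>I. c i * a i j))"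
proof -
  define residues where "residues = {0..<int p}"
  define \<phi> where "\<phi> c = (\<lambda>j\<in>J. (\<Sum>i\<in>I. c i * a i j) mod int p)" for c
  have card_residues: "card (K \<rightarrow>\<^sub>E residues) = p ^ card K" if "finite K" for K :: "'k set"
    using that by (simp add: card_PiE residues_def)
  have "card (J \<rightarrow>\<^sub>E residues) < card (I \<rightarrow>\<^sub>E residues)"
    using assms by (simp add: card_residues)
  moreover have "\<phi> ` (I \<rightarrow>\<^sub>E residues) \<subseteq> J \<rightarrow>\<^sub>E residues"
    using assms by (auto simp: \<phi>_def residues_def)
  ultimately have "\<not> inj_on \<phi> (I \<rightarrow>\<^sub>E residues)"
    using card_inj_on_le[of \<phi> "I \<rightarrow>\<^sub>E residues" "J \<rightarrow>\<^sub>E residues"] assms(2)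
    by (fastforce simp: residues_def intro!: finite_PiE)
  then obtain u v where u: "u \<in> I \<rightarrow>\<^sub>E residues" and v: "v \<in> I \<rightarrow>\<^sub>E residues" and "u \<noteq> v" "\<phi> u = \<phi> v"
    by (auto simp: inj_on_def)
  then obtain i where i: "i \<in> I" "u i \<noteq> v i" by (meson PiE_ext)
  have "u i \<in> residues" "v i \<in> residues" using u v i by auto
  then have "\<bar>u i - v i\<bar> < int p" by (auto simp: residues_def)
  then have "\<not> int p dvd u i - v i" using i(2) by (auto dest: dvd_imp_le_int[rotated])
  moreover have "int p dvd (\<Sum>i\<in>I. (u i - v i) * a i j)" if "j \<in> J" for j
  proof -
    have "(\<Sum>i\<in>I. u i * a i j) mod int p = (\<Sum>i\<in>I. v i * a i j) mod int p"
      using fun_cong[OF \<open>\<phi> u = \<phi> v\<close>, of j] that by (simp add: \<phi>_def)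
    then show ?thesis by (simp add: mod_eq_dvd_iff left_diff_distrib sum_subtractf)
  qed
  ultimately show ?thesis using i(1) by (intro exI[of _ "\<lambda>i. u i - v i"]) auto
qed

lemma card_le_if_diagonal_mod_prime:
  fixes a :: "'i \<Rightarrow> 'j \<Rightarrow> int" and p :: nat
  assumes fin: "finite I" "finite J" and p: "prime p"
    and f: "\<And>x y. x \<in> I \<Longrightarrow> y \<in> I \<Longrightarrow> f x y = (\<Sum>j\<in>J. a x j * b j y)"
    and diagonal: "\<And>x. x \<in> I \<Longrightarrow> \<not> int p dvd f x x"
    and off_diagonal: "\<And>x y. x \<in> I \<Longrightarrow> y \<in> I \<Longrightarrow> x \<noteq> y \<Longrightarrow> int p dvd f x y"
  shows "card I \<le> card J"
proof (rule ccontr)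
  assume "\<not> card I \<le> card J"
  then obtain c where nontrivial: "\<exists>x\<in>I. \<not> int p dvd c x"
    and dependent: "\<And>j. j \<in> J \<Longrightarrow> int p dvd (\<Sum>x\<in>I. c x * a x j)"
    using exists_dependency_mod[OF fin _ prime_gt_1_nat[OF p], of a] by auto
  have "int p dvd c y" if y: "y \<in> I" for y
  proof -
    have "(\<Sum>x\<in>I. c x * f x y) = (\<Sum>j\<in>J. (\<Sum>x\<in>I. c x * a x j) * b j y)"
      using y by (simp add: f sum_distrib_left sum_distrib_right mult.assoc sum.swap[of _ I])
    then have "int p dvd (\<Sum>x\<in>I. c x * f x y)"
      using dependent by (auto intro: dvd_sum)
    then have "int p dvd c y * f y y + (\<Sum>x\<in>I - {y}. c x * f x y)"
      by (simp add: sum.remove[OF fin(1) y])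
    moreover have "int p dvd (\<Sum>x\<in>I - {y}. c x * f x y)"
      using y off_diagonal by (intro dvd_sum) auto
    ultimately have "int p dvd c y * f y y" by (simp add: dvd_add_left_iff)
    then show ?thesis using diagonal[OF y] p by (simp add: prime_dvd_mult_iff)
  qed
  then show False using nontrivial by blast
qed

definition spanned_on :: "'a set \<Rightarrow> 'j set \<Rightarrow> ('j \<Rightarrow> 'a \<Rightarrow> int) \<Rightarrow> ('a \<Rightarrow> int) \<Rightarrow> bool" where
  "spanned_on D J b f \<longleftrightarrow> (\<exists>c. \<forall>y\<in>D. f y = (\<Sum>j\<in>J. c j * b j y))"

lemma spanned_on_base:
  assumes "finite J" "j \<in> J" "\<And>y. y \<in> D \<Longrightarrow> f y = s * b j y"
  shows "spanned_on D J b f"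
  unfolding spanned_on_def using assms
  by (intro exI[of _ "\<lambda>j'. if j' = j then s else 0"])
    (simp add: if_distrib[of "\<lambda>u. u * _"] cong: if_cong)

lemma spanned_on_add:
  assumes "spanned_on D J b f" "spanned_on D J b g"
  shows "spanned_on D J b (\<lambda>y. f y + g y)"
proof -
  obtain c d where "\<forall>y\<in>D. f y = (\<Sum>j\<in>J. c j * b j y)" "\<forall>y\<in>D. g y = (\<Sum>j\<in>J. d j * b j y)"
    using assms by (auto simp: spanned_on_def)
  then show ?thesis unfolding spanned_on_def
    by (intro exI[of _ "\<lambda>j. c j + d j"]) (simp add: distrib_right sum.distrib)
qed

lemma spanned_on_scale:
  assumes "spanned_on D J b f"
  shows "spanned_on D J b (\<lambda>y. s * f y)"
proof -
  obtain c where "\<forall>y\<in>D. f y = (\<Sum>j\<in>J. c j * b j y)"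
    using assms by (auto simp: spanned_on_def)
  then show ?thesis unfolding spanned_on_def
    by (intro exI[of _ "\<lambda>j. s * c j"]) (simp add: sum_distrib_left mult.assoc)
qed

lemma spanned_on_sum:
  assumes "finite S" "\<And>i. i \<in> S \<Longrightarrow> spanned_on D J b (f i)"
  shows "spanned_on D J b (\<lambda>y. \<Sum>i\<in>S. f i y)"
  using assms
proof (induction S rule: finite_induct)
  case empty
  show ?case unfolding spanned_on_def by (rule exI[of _ "\<lambda>_. 0"]) simp
qed (auto intro: spanned_on_add)

lemma spanned_on_cong:
  "spanned_on D J b f \<Longrightarrow> (\<And>y. y \<in> D \<Longrightarrow> f y = g y) \<Longrightarrow> spanned_on D J b g"
  by (auto simp: spanned_on_def)

lemma spanned_on_mult:
  assumes "spanned_on D J b f" "finite J"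
    and "\<And>j. j \<in> J \<Longrightarrow> spanned_on D J' b' (\<lambda>y. g y * b j y)"
  shows "spanned_on D J' b' (\<lambda>y. g y * f y)"
proof -
  obtain c where "\<And>y. y \<in> D \<Longrightarrow> f y = (\<Sum>j\<in>J. c j * b j y)"
    using assms(1) by (auto simp: spanned_on_def)
  moreover have "spanned_on D J' b' (\<lambda>y. \<Sum>j\<in>J. c j * (g y * b j y))"
    using assms by (intro spanned_on_sum spanned_on_scale)
  ultimately show ?thesis
    by (elim spanned_on_cong) (simp add: sum_distrib_left mult.left_commute)
qed

section \<open>Words without orthogonal pairs\<close>

type_synonym word = "nat \<Rightarrow> int \<times> int"

definition letters :: "(int \<times> int) set" where
  "letters = {(0, 0), (1, 0), (-1, 0), (0, 1), (0, -1)}"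

definition word_supp :: "nat \<Rightarrow> word \<Rightarrow> nat set" where
  "word_supp t x = {j\<in>{..<t}. x j \<noteq> (0, 0)}"

definition words :: "nat \<Rightarrow> nat \<Rightarrow> word set" where
  "words t p = {x \<in> {..<t} \<rightarrow>\<^sub>E letters. card (word_supp t x) = p}"

definition word_inner :: "nat \<Rightarrow> word \<Rightarrow> word \<Rightarrow> int" where
  "word_inner t x y = (\<Sum>j<t. fst (x j) * fst (y j) + snd (x j) * snd (y j))"

text \<open>
  The exponents \<open>(a, b)\<close> of the monomials \<open>u ^ a * v ^ b\<close> to which every polynomial in one
  letter \<open>(u, v)\<close> reduces by the relations \<open>u * v = 0\<close>, \<open>u ^ 3 = u\<close> and \<open>v ^ 3 = v\<close>.
\<close>

definition exponents :: "(nat \<times> nat) set" where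
  "exponents = {(0, 0), (1, 0), (0, 1), (2, 0), (0, 2)}"

definition monomials :: "nat \<Rightarrow> nat \<Rightarrow> (nat \<Rightarrow> nat \<times> nat) set" where
  "monomials t r = {m \<in> {..<t} \<rightarrow>\<^sub>E exponents. (\<Sum>j<t. fst (m j) + snd (m j)) \<le> r}"

definition monomial_val :: "nat \<Rightarrow> (nat \<Rightarrow> nat \<times> nat) \<Rightarrow> word \<Rightarrow> int" where
  "monomial_val t m y = (\<Prod>j<t. fst (y j) ^ fst (m j) * snd (y j) ^ snd (m j))"

abbreviation spanned_by_monomials :: "nat \<Rightarrow> nat \<Rightarrow> (word \<Rightarrow> int) \<Rightarrow> bool" where
  "spanned_by_monomials t r \<equiv> spanned_on ({..<t} \<rightarrow>\<^sub>E letters) (monomials t r) (monomial_val t)"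

lemma finite_letters: "finite letters"
  by (simp add: letters_def)

lemma finite_exponents: "finite exponents"
  by (simp add: exponents_def)

lemma card_nonzero_letters: "card (letters - {(0, 0)}) = 4"
  by (simp add: letters_def)

lemma finite_word_supp: "finite (word_supp t x)"
  by (simp add: word_supp_def)

lemma finite_words: "finite (words t p)"
  unfolding words_def
  by (rule finite_subset[of _ "{..<t} \<rightarrow>\<^sub>E letters"]) (auto intro!: finite_PiE finite_letters)

lemma finite_monomials: "finite (monomials t r)"
  unfolding monomials_def
  by (rule finite_subset[of _ "{..<t} \<rightarrow>\<^sub>E exponents"]) (auto intro!: finite_PiE finite_exponents)

lemma constant_monomial: "(\<lambda>j\<in>{..<t}. (0, 0)) \<in> monomials t r"
  by (auto simp: monomials_def exponents_def)

lemma coordinate_times_letter_monomial: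
  assumes "e \<in> exponents" "\<kappa> = fst \<or> \<kappa> = snd"
  obtains s e' where "e' \<in> exponents" "fst e' + snd e' \<le> Suc (fst e + snd e)"
    and "\<And>u. u \<in> letters \<Longrightarrow>
      \<kappa> u * (fst u ^ fst e * snd u ^ snd e) = s * (fst u ^ fst e' * snd u ^ snd e')"
  using assms(2)
proof
  assume "\<kappa> = fst"
  then show thesis
    using assms(1)
    by (intro that[of "(if fst e = 1 then 2 else 1, 0)" "if snd e = 0 then 1 else 0"])
      (auto simp: exponents_def letters_def)
next
  assume "\<kappa> = snd"
  then show thesis
    using assms(1)
    by (intro that[of "(0, if snd e = 1 then 2 else 1)" "if fst e = 0 then 1 else 0"])
      (auto simp: exponents_def letters_def)
qed

lemma spanned_coordinate_times_monomial:
  assumes m: "m \<in> monomials t r" and i: "i < t" and \<kappa>: "\<kappa> = fst \<or> \<kappa> = snd"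
  shows "spanned_by_monomials t (Suc r) (\<lambda>y. \<kappa> (y i) * monomial_val t m y)"
proof -
  have m_fun: "m \<in> {..<t} \<rightarrow>\<^sub>E exponents" and m_degree: "(\<Sum>j<t. fst (m j) + snd (m j)) \<le> r"
    using m by (auto simp: monomials_def)
  have "m i \<in> exponents" using m_fun i by auto
  from coordinate_times_letter_monomial[OF this \<kappa>] obtain s e where
    e: "e \<in> exponents" "fst e + snd e \<le> Suc (fst (m i) + snd (m i))"
    and reduce: "\<And>u. u \<in> letters \<Longrightarrow>
      \<kappa> u * (fst u ^ fst (m i) * snd u ^ snd (m i)) = s * (fst u ^ fst e * snd u ^ snd e)"
    by blast
  define m' where "m' = m(i := e)"
  have i': "i \<in> {..<t}" using i by simp
  have m'_fun: "m' \<in> {..<t} \<rightarrow>\<^sub>E exponents"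
    using m_fun e i by (auto simp: m'_def PiE_def extensional_def)
  define deg_rest where "deg_rest = (\<Sum>j\<in>{..<t} - {i}. fst (m j) + snd (m j))"
  have "(\<Sum>j<t. fst (m' j) + snd (m' j)) = (fst e + snd e) + deg_rest"
    unfolding deg_rest_def by (subst sum.remove[OF finite_lessThan i']) (simp add: m'_def)
  also have "\<dots> \<le> Suc ((fst (m i) + snd (m i)) + deg_rest)"
    using e(2) by simp
  also have "(fst (m i) + snd (m i)) + deg_rest = (\<Sum>j<t. fst (m j) + snd (m j))"
    unfolding deg_rest_def by (rule sum.remove[OF finite_lessThan i', symmetric])
  finally have "m' \<in> monomials t (Suc r)"
    using m'_fun m_degree by (simp add: monomials_def)
  moreover have "\<kappa> (y i) * monomial_val t m y = s * monomial_val t m' y"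
    if y: "y \<in> {..<t} \<rightarrow>\<^sub>E letters" for y
  proof -
    define rest where "rest = (\<Prod>j\<in>{..<t} - {i}. fst (y j) ^ fst (m j) * snd (y j) ^ snd (m j))"
    have "monomial_val t m y = (fst (y i) ^ fst (m i) * snd (y i) ^ snd (m i)) * rest"
      unfolding monomial_val_def rest_def by (rule prod.remove[OF finite_lessThan i'])
    moreover have "monomial_val t m' y = (fst (y i) ^ fst e * snd (y i) ^ snd e) * rest"
      unfolding monomial_val_def rest_def
      by (subst prod.remove[OF finite_lessThan i']) (simp add: m'_def)
    moreover have "y i \<in> letters" using y i by auto
    ultimately show ?thesis using reduce by (simp flip: mult.assoc)
  qed
  ultimately show ?thesis by (rule spanned_on_base[OF finite_monomials])
qed

lemma spanned_coordinate_times: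
  assumes "spanned_by_monomials t r f" "i < t" "\<kappa> = fst \<or> \<kappa> = snd"
  shows "spanned_by_monomials t (Suc r) (\<lambda>y. \<kappa> (y i) * f y)"
  by (rule spanned_on_mult[OF assms(1) finite_monomials])
    (intro spanned_coordinate_times_monomial assms)

lemma spanned_by_monomials_Suc:
  assumes "spanned_by_monomials t r f"
  shows "spanned_by_monomials t (Suc r) f"
proof -
  have "spanned_by_monomials t (Suc r) (\<lambda>y. 1 * f y)"
  proof (rule spanned_on_mult[OF assms finite_monomials])
    fix m assume "m \<in> monomials t r"
    then have "m \<in> monomials t (Suc r)" by (simp add: monomials_def)
    then show "spanned_by_monomials t (Suc r) (\<lambda>y. 1 * monomial_val t m y)"
      by (rule spanned_on_base[OF finite_monomials]) (rule refl)
  qed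
  then show ?thesis by simp
qed

lemma spanned_prod_word_inner:
  "spanned_by_monomials t n (\<lambda>y. \<Prod>i\<in>{1..n}. word_inner t x y - int i)"
proof (induction n)
  case 0
  show ?case
    by (rule spanned_on_base[OF finite_monomials constant_monomial, where s = 1])
      (simp add: monomial_val_def)
next
  case (Suc n)
  let ?f = "\<lambda>y. \<Prod>i\<in>{1..n}. word_inner t x y - int i"
  have "spanned_by_monomials t (Suc n) (\<lambda>y.
      (\<Sum>j<t. fst (x j) * (fst (y j) * ?f y) + snd (x j) * (snd (y j) * ?f y))
        + (- int (Suc n)) * ?f y)"
    using Suc
    by (intro spanned_on_add spanned_on_sum spanned_on_scale spanned_coordinate_times
        spanned_by_monomials_Suc) auto
  then show ?case
    by (rule spanned_on_cong)
      (simp add: word_inner_def atLeastAtMostSuc_conv sum_distrib_right algebra_simps)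
qed

lemma word_inner_self:
  assumes "x \<in> words t p"
  shows "word_inner t x x = int p"
proof -
  have "word_inner t x x = (\<Sum>j<t. if x j \<noteq> (0, 0) then 1 else 0)"
    unfolding word_inner_def using assms
    by (intro sum.cong refl) (fastforce simp: words_def letters_def)
  also have "\<dots> = int (card (word_supp t x))"
    by (simp add: sum.If_cases word_supp_def Int_def)
  finally show ?thesis using assms by (simp add: words_def)
qed

lemma sum_power2_diff_scaled_word:
  assumes "s * s = (1::int)"
  shows "(\<Sum>j<t. (fst (x j) - s * fst (y j))\<^sup>2 + (snd (x j) - s * snd (y j))\<^sup>2)
    = word_inner t x x + word_inner t y y - 2 * (s * word_inner t x y)"
proof -
  have square: "(u - s * v)\<^sup>2 = u * u + v * v - 2 * (s * (u * v))" for u v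
  proof -
    have "(u - s * v)\<^sup>2 = u * u + (s * s) * (v * v) - 2 * (s * (u * v))"
      by (simp add: power2_eq_square algebra_simps)
    then show ?thesis by (simp add: assms)
  qed
  show ?thesis
    unfolding word_inner_def sum_distrib_left sum.distrib[symmetric] sum_subtractf[symmetric] square
    by (intro sum.cong refl) (simp add: algebra_simps)
qed

lemma scaled_word_inner_le:
  assumes x: "x \<in> words t p" and y: "y \<in> words t p" and s: "s * s = 1"
  shows "s * word_inner t x y \<le> int p"
    and "s * word_inner t x y = int p \<Longrightarrow> \<forall>j<t. x j = (s * fst (y j), s * snd (y j))"
proof -
  have norm: "(\<Sum>j<t. (fst (x j) - s * fst (y j))\<^sup>2 + (snd (x j) - s * snd (y j))\<^sup>2)
      = 2 * (int p - s * word_inner t x y)"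
    using sum_power2_diff_scaled_word[OF s] word_inner_self[OF x] word_inner_self[OF y] by simp
  have "0 \<le> (\<Sum>j<t. (fst (x j) - s * fst (y j))\<^sup>2 + (snd (x j) - s * snd (y j))\<^sup>2)"
    by (intro sum_nonneg) simp
  then show "s * word_inner t x y \<le> int p" unfolding norm by simp
  assume "s * word_inner t x y = int p"
  then have "(\<Sum>j<t. (fst (x j) - s * fst (y j))\<^sup>2 + (snd (x j) - s * snd (y j))\<^sup>2) = 0"
    unfolding norm by simp
  then have "\<forall>j\<in>{..<t}. (fst (x j) - s * fst (y j))\<^sup>2 + (snd (x j) - s * snd (y j))\<^sup>2 = 0"
    by (subst (asm) sum_nonneg_eq_0_iff) auto
  then show "\<forall>j<t. x j = (s * fst (y j), s * snd (y j))"
    by (auto simp: sum_power2_eq_zero_iff prod_eq_iff)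
qed

lemma dvd_word_inner_cases:
  assumes x: "x \<in> words t p" and y: "y \<in> words t p" and "p > 0"
    and dvd: "int p dvd word_inner t x y"
  obtains "word_inner t x y = 0" | "x = y" | "\<forall>j<t. x j = (- fst (y j), - snd (y j))"
proof -
  obtain q where q: "word_inner t x y = int p * q" using dvd by (rule dvdE)
  have "int p * q \<le> int p * 1" "int p * (- q) \<le> int p * 1"
    using scaled_word_inner_le(1)[OF x y, of 1] scaled_word_inner_le(1)[OF x y, of "-1"] q
    by simp_all
  then have "q \<le> 1" "- q \<le> 1"
    using \<open>p > 0\<close> by (simp_all only: mult_le_cancel_left_pos of_nat_0_less_iff)
  then consider "q = 0" | "q = 1" | "q = -1" by linarith
  then show thesis
  proof cases
    case 1 then show thesis using q that(1) by simp
  next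
    case 2
    then have "\<forall>j<t. x j = y j" using scaled_word_inner_le(2)[OF x y, of 1] q by simp
    then have "x = y"
      using x y by (intro PiE_ext[of x "{..<t}" "\<lambda>_. letters"]) (auto simp: words_def)
    then show thesis by (rule that(2))
  next
    case 3 then show thesis using scaled_word_inner_le(2)[OF x y, of "-1"] q that(3) by simp
  qed
qed

lemma dvd_prod_shifted_iff:
  assumes p: "prime p"
  shows "int p dvd (\<Prod>i\<in>{1..p - 1}. n - int i) \<longleftrightarrow> \<not> int p dvd n"
proof
  assume "int p dvd (\<Prod>i\<in>{1..p - 1}. n - int i)"
  then obtain i where i: "i \<in> {1..p - 1}" "int p dvd n - int i"
    using p by (auto simp: prime_dvd_prod_iff)
  then have "\<not> p dvd i" by (auto dest: dvd_imp_le)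
  then show "\<not> int p dvd n" using i(2) by (auto simp: dvd_diff_right_iff)
next
  assume "\<not> int p dvd n"
  then have "n mod int p \<noteq> 0" by auto
  moreover have "0 \<le> n mod int p" "n mod int p < int p" using prime_gt_0_nat[OF p] by auto
  ultimately have "nat (n mod int p) \<in> {1..p - 1}" by auto
  moreover have "int p dvd n - int (nat (n mod int p))"
    using \<open>0 \<le> n mod int p\<close> by (simp add: dvd_minus_mod)
  ultimately show "int p dvd (\<Prod>i\<in>{1..p - 1}. n - int i)"
    by (meson dvd_prodI dvd_trans finite_atLeastAtMost)
qed

lemma card_le_card_monomials:
  assumes p: "prime p" and I: "I \<subseteq> words t p"
    and not_dvd: "\<And>x y. x \<in> I \<Longrightarrow> y \<in> I \<Longrightarrow> x \<noteq> y \<Longrightarrow> \<not> int p dvd word_inner t x y"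
  shows "card I \<le> card (monomials t (p - 1))"
proof -
  define f where "f x y = (\<Prod>i\<in>{1..p - 1}. word_inner t x y - int i)" for x y
  have "\<forall>x. \<exists>c. \<forall>y\<in>{..<t} \<rightarrow>\<^sub>E letters. f x y = (\<Sum>m\<in>monomials t (p - 1). c m * monomial_val t m y)"
    using spanned_prod_word_inner by (auto simp: spanned_on_def f_def)
  then obtain a where a: "\<And>x y. y \<in> {..<t} \<rightarrow>\<^sub>E letters \<Longrightarrow>
      f x y = (\<Sum>m\<in>monomials t (p - 1). a x m * monomial_val t m y)"
    by metis
  show ?thesis
  proof (rule card_le_if_diagonal_mod_prime[of I "monomials t (p - 1)" p f a "monomial_val t"])
    show "finite I" using I finite_words by (rule finite_subset)
    show "f x y = (\<Sum>m\<in>monomials t (p - 1). a x m * monomial_val t m y)" if "y \<in> I" for x y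
      using that I by (intro a) (auto simp: words_def)
    show "\<not> int p dvd f x x" if "x \<in> I" for x
      using that I word_inner_self[of x t p] unfolding f_def dvd_prod_shifted_iff[OF p] by auto
    show "int p dvd f x y" if "x \<in> I" "y \<in> I" "x \<noteq> y" for x y
      using that unfolding f_def dvd_prod_shifted_iff[OF p] by (rule not_dvd)
  qed (use p finite_monomials in auto)
qed

definition first_letter :: "nat \<Rightarrow> word \<Rightarrow> int \<times> int" where
  "first_letter t x = x (Min (word_supp t x))"

definition vertical_parity :: "nat \<Rightarrow> word \<Rightarrow> bool" where
  "vertical_parity t x \<longleftrightarrow> even (\<Sum>j<t. snd (x j) * snd (x j))"

lemma Min_word_supp:
  assumes "x \<in> words t p" "p > 0"
  shows "Min (word_supp t x) < t" "first_letter t x \<in> letters - {(0, 0)}"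
proof -
  have "word_supp t x \<noteq> {}" using assms by (auto simp: words_def)
  then have "Min (word_supp t x) \<in> word_supp t x" by (intro Min_in finite_word_supp)
  then show "Min (word_supp t x) < t" "first_letter t x \<in> letters - {(0, 0)}"
    using assms(1) by (auto simp: first_letter_def word_supp_def words_def)
qed

lemma first_letter_antipodal:
  assumes x: "x \<in> words t p" and "p > 0" and antipodal: "\<forall>j<t. x j = (- fst (y j), - snd (y j))"
  shows "first_letter t x \<noteq> first_letter t y"
proof
  assume eq: "first_letter t x = first_letter t y"
  have "word_supp t x = word_supp t y"
    using antipodal by (auto simp: word_supp_def prod_eq_iff)
  then have "first_letter t x = (- fst (first_letter t y), - snd (first_letter t y))"
    using antipodal Min_word_supp(1)[OF x \<open>p > 0\<close>] by (simp add: first_letter_def)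
  then show False
    using eq Min_word_supp(2)[OF x \<open>p > 0\<close>] by (auto simp: prod_eq_iff)
qed

text \<open>
  Modulo 2 the inner product of two nonzero letters with second coordinates \<open>v\<close> and \<open>v'\<close> is
  \<open>1 + v\<^sup>2 + v'\<^sup>2\<close>.
\<close>

lemma odd_word_inner:
  assumes x: "x \<in> words t p" and y: "y \<in> words t p" and "odd p"
    and supp: "word_supp t x = word_supp t y"
    and parity: "vertical_parity t x = vertical_parity t y"
  shows "odd (word_inner t x y)"
proof -
  have "even (\<Sum>j<t. (fst (x j) * fst (y j) + snd (x j) * snd (y j))
      + snd (x j) * snd (x j) + snd (y j) * snd (y j)
      + (fst (x j) * fst (x j) + snd (x j) * snd (x j)))"
  proof (rule dvd_sum)
    fix j assume j: "j \<in> {..<t}"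
    then have "x j \<in> letters" "y j \<in> letters" using x y by (auto simp: words_def)
    moreover have "x j = (0, 0) \<longleftrightarrow> y j = (0, 0)" using supp j by (auto simp: word_supp_def)
    ultimately show "even ((fst (x j) * fst (y j) + snd (x j) * snd (y j))
      + snd (x j) * snd (x j) + snd (y j) * snd (y j)
      + (fst (x j) * fst (x j) + snd (x j) * snd (x j)))"
      by (auto simp: letters_def)
  qed
  then have "even (word_inner t x y + (\<Sum>j<t. snd (x j) * snd (x j)) + (\<Sum>j<t. snd (y j) * snd (y j))
      + word_inner t x x)"
    by (simp only: word_inner_def sum.distrib)
  then show ?thesis
    using \<open>odd p\<close> parity word_inner_self[OF x] by (auto simp: vertical_parity_def)
qed

lemma orthogonal_if_dvd_word_inner:
  assumes x: "x \<in> words t p" and y: "y \<in> words t p" and "p > 0" "odd p" "x \<noteq> y"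
    and "int p dvd word_inner t x y"
    and "first_letter t x = first_letter t y" "vertical_parity t x = vertical_parity t y"
  shows "word_inner t x y = 0 \<and> word_supp t x \<noteq> word_supp t y"
  using x y assms(3,6)
proof (cases rule: dvd_word_inner_cases)
  case 1
  then show ?thesis using odd_word_inner[OF x y \<open>odd p\<close>] assms by auto
next
  case 3
  then show ?thesis using first_letter_antipodal[OF x \<open>p > 0\<close>] assms by blast
qed (use assms in simp)

lemma monochromatic_orthogonal_words:
  assumes p: "prime p" "odd p" and c: "c ` words t p \<subseteq> {..<k}"
    and large: "8 * k * card (monomials t (p - 1)) < card (words t p)"
  shows "\<exists>x\<in>words t p. \<exists>y\<in>words t p.
    c x = c y \<and> word_inner t x y = 0 \<and> word_supp t x \<noteq> word_supp t y"
proof -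
  have "p > 0" using p(1) by (rule prime_gt_0_nat)
  define K where "K = {..<k} \<times> (letters - {(0, 0)}) \<times> (UNIV :: bool set)"
  define \<kappa> where "\<kappa> x = (c x, first_letter t x, vertical_parity t x)" for x
  have "words t p \<noteq> {}" using large by auto
  have "\<kappa> \<in> words t p \<rightarrow> K"
    using c Min_word_supp(2)[OF _ \<open>p > 0\<close>] by (auto simp: \<kappa>_def K_def)
  moreover have "finite K" by (simp add: K_def finite_letters)
  ultimately obtain v where v: "card (words t p) \<le> card (\<kappa> -` {v} \<inter> words t p) * card K"
    using \<open>words t p \<noteq> {}\<close> finite_words pigeonhole_card[of \<kappa> "words t p" K] by blast
  define C where "C = \<kappa> -` {v} \<inter> words t p"
  have "8 * k * card (monomials t (p - 1)) < card (words t p)" by (rule large)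
  also have "\<dots> \<le> 8 * k * card C"
    using v by (simp add: K_def C_def card_cartesian_product card_nonzero_letters mult.commute)
  finally have "\<not> card C \<le> card (monomials t (p - 1))" by simp
  moreover have "C \<subseteq> words t p" by (simp add: C_def)
  ultimately obtain x y where "x \<in> C" "y \<in> C" "x \<noteq> y" "int p dvd word_inner t x y"
    using card_le_card_monomials[OF p(1), of C t] by blast
  then show ?thesis
    using orthogonal_if_dvd_word_inner[of x t p y] \<open>p > 0\<close> p(2) by (auto simp: C_def \<kappa>_def)
qed

section \<open>Comparison of words and monomials\<close>

lemma card_PiE_card_support:
  assumes "finite A" "finite L" "z \<notin> L"
  shows "card {f \<in> A \<rightarrow>\<^sub>E insert z L. card {a\<in>A. f a \<noteq> z} = n} = (card A choose n) * card L ^ n"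
proof -
  define supp where "supp f = {a\<in>A. f a \<noteq> z}" for f
  define extend where "extend B g = (\<lambda>a\<in>A. if a \<in> B then g a else z)" for B g
  let ?F = "{f \<in> A \<rightarrow>\<^sub>E insert z L. card (supp f) = n}"
  let ?S = "{B. B \<subseteq> A \<and> card B = n}"
  have supp_extend: "supp (extend B g) = B" if "B \<subseteq> A" "g \<in> B \<rightarrow>\<^sub>E L" for B g
    using that \<open>z \<notin> L\<close> by (auto simp: supp_def extend_def PiE_iff)
  have extend_PiE: "extend B g \<in> A \<rightarrow>\<^sub>E insert z L" if "g \<in> B \<rightarrow>\<^sub>E L" for B g
    using that by (auto simp: extend_def PiE_iff)
  have restrict_extend: "restrict (extend B g) B = g" if "B \<subseteq> A" "g \<in> B \<rightarrow>\<^sub>E L" for B g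
    using that by (auto simp: extend_def fun_eq_iff PiE_def extensional_def)
  have extend_restrict: "extend (supp f) (restrict f (supp f)) = f" if "f \<in> A \<rightarrow>\<^sub>E insert z L" for f
    using that by (auto simp: extend_def supp_def fun_eq_iff PiE_def extensional_def)
  have restrict_supp: "restrict f (supp f) \<in> supp f \<rightarrow>\<^sub>E L" if "f \<in> A \<rightarrow>\<^sub>E insert z L" for f
    using that by (auto simp: supp_def)
  have "bij_betw (\<lambda>f. (supp f, restrict f (supp f))) ?F (SIGMA B:?S. B \<rightarrow>\<^sub>E L)"
  proof (rule bij_betw_byWitness[where f' = "\<lambda>(B, g). extend B g"])
    show "(\<lambda>f. (supp f, restrict f (supp f))) ` ?F \<subseteq> (SIGMA B:?S. B \<rightarrow>\<^sub>E L)"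
      using restrict_supp by (auto simp: supp_def)
    show "(\<lambda>(B, g). extend B g) ` (SIGMA B:?S. B \<rightarrow>\<^sub>E L) \<subseteq> ?F"
      using extend_PiE by (auto simp: supp_extend)
  qed (auto simp: supp_extend restrict_extend extend_restrict)
  then have "card ?F = card (SIGMA B:?S. B \<rightarrow>\<^sub>E L)" by (rule bij_betw_same_card)
  also have "\<dots> = (\<Sum>B\<in>?S. card (B \<rightarrow>\<^sub>E L))"
    using assms by (intro card_SigmaI) (auto intro!: finite_PiE intro: finite_subset)
  also have "\<dots> = (\<Sum>B\<in>?S. card L ^ n)"
    using assms by (intro sum.cong) (auto simp: card_PiE dest: finite_subset)
  also have "\<dots> = (card A choose n) * card L ^ n"
    using assms by (simp add: n_subsets)
  finally show ?thesis unfolding supp_def .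
qed

lemma card_words: "card (words t p) = (t choose p) * 4 ^ p"
proof -
  have "letters = insert (0, 0) (letters - {(0, 0)})" by (auto simp: letters_def)
  then show ?thesis
    using card_PiE_card_support[of "{..<t}" "letters - {(0, 0)}" "(0, 0)" p]
    by (simp add: words_def word_supp_def finite_letters card_nonzero_letters)
qed

lemma card_monomials_le:
  fixes z :: real
  assumes "0 < z" "z \<le> 1"
  shows "card (monomials t r) * z ^ r \<le> (1 + 2 * z + 2 * z\<^sup>2) ^ t"
proof -
  have "card (monomials t r) * z ^ r = (\<Sum>m\<in>monomials t r. z ^ r)" by simp
  also have "\<dots> \<le> (\<Sum>m\<in>monomials t r. z ^ (\<Sum>j<t. fst (m j) + snd (m j)))"
    using assms by (intro sum_mono power_decreasing) (auto simp: monomials_def)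
  also have "\<dots> \<le> (\<Sum>m\<in>{..<t} \<rightarrow>\<^sub>E exponents. z ^ (\<Sum>j<t. fst (m j) + snd (m j)))"
    using assms by (intro sum_mono2 finite_PiE finite_exponents) (auto simp: monomials_def)
  also have "\<dots> = (\<Sum>m\<in>{..<t} \<rightarrow>\<^sub>E exponents. \<Prod>j<t. z ^ (fst (m j) + snd (m j)))"
    by (simp add: power_sum)
  also have "\<dots> = (\<Prod>j<t. \<Sum>e\<in>exponents. z ^ (fst e + snd e))"
    by (rule prod_sum_PiE[symmetric]) (auto simp: finite_exponents)
  also have "(\<Sum>e\<in>exponents. z ^ (fst e + snd e)) = 1 + 2 * z + 2 * z\<^sup>2"
    by (simp add: exponents_def power2_eq_square)
  finally show ?thesis by simp
qed

lemma Suc_times_binomial_Suc: "Suc k * (t choose Suc k) = (t - k) * (t choose k)"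
  using binomial_absorption[of k t] binomial_absorb_comp[of t k] by simp

definition binomial_term :: "nat \<Rightarrow> real \<Rightarrow> nat \<Rightarrow> real" where
  "binomial_term t u k = real (t choose k) * u ^ k"

lemma binomial_term_nonneg: "0 \<le> u \<Longrightarrow> 0 \<le> binomial_term t u k"
  by (simp add: binomial_term_def)

lemma binomial_term_Suc:
  "real (Suc k) * binomial_term t u (Suc k) = (real t - real k) * u * binomial_term t u k"
proof (cases "k \<le> t")
  case True
  then have "real (Suc k) * real (t choose Suc k) = (real t - real k) * real (t choose k)"
    using Suc_times_binomial_Suc[of k t] by (metis of_nat_diff of_nat_mult)
  then show ?thesis
    by (simp add: binomial_term_def mult.assoc[symmetric] mult.commute[of u])
qed (simp add: binomial_term_def binomial_eq_0)

lemma binomial_term_le_Suc: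
  assumes "0 \<le> u" "real (Suc k) \<le> (real t - real k) * u"
  shows "binomial_term t u k \<le> binomial_term t u (Suc k)"
proof -
  have "real (Suc k) * binomial_term t u k \<le> real (Suc k) * binomial_term t u (Suc k)"
    unfolding binomial_term_Suc using assms by (intro mult_right_mono binomial_term_nonneg)
  then show ?thesis by simp
qed

lemma binomial_term_Suc_le:
  assumes "0 \<le> u" "(real t - real k) * u \<le> real (Suc k)"
  shows "binomial_term t u (Suc k) \<le> binomial_term t u k"
proof -
  have "real (Suc k) * binomial_term t u (Suc k) \<le> real (Suc k) * binomial_term t u k"
    unfolding binomial_term_Suc using assms by (intro mult_right_mono binomial_term_nonneg)
  then show ?thesis by simp
qed

text \<open>The hypothesis says that \<open>s\<close> is the mean of the binomial distribution with odds \<open>u\<close>.\<close>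

lemma binomial_term_le_mode:
  assumes "0 \<le> u" and mean: "(real t - real s) * u = real s"
  shows "binomial_term t u k \<le> binomial_term t u s"
proof -
  have shift: "(real t - real k) * u = real s + (real s - real k) * u" for k
    using mean by (simp add: algebra_simps)
  show ?thesis
  proof (cases "k \<le> s")
    case True
    have increasing: "binomial_term t u k \<le> binomial_term t u (Suc k)" if "k < s" for k
      using that \<open>0 \<le> u\<close> by (intro binomial_term_le_Suc) (simp_all add: shift add_increasing2)
    show ?thesis
      using True by (induction rule: inc_induct) (auto intro: increasing order_trans)
  next
    case False
    have decreasing: "binomial_term t u (Suc k) \<le> binomial_term t u k" if "s \<le> k" for k
      using that \<open>0 \<le> u\<close>
      by (intro binomial_term_Suc_le) (simp_all add: shift add_decreasing2 mult_nonpos_nonneg)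
    have "s \<le> k" using False by simp
    then show ?thesis
      by (induction rule: dec_induct) (auto intro: decreasing order_trans)
  qed
qed

lemma binomial_power_le_mode:
  assumes "0 \<le> u" "(real t - real s) * u = real s"
  shows "(1 + u) ^ t \<le> (real t + 1) * binomial_term t u s"
proof -
  have "(1 + u) ^ t = (\<Sum>k\<le>t. binomial_term t u k)"
    using binomial_ring[of u 1 t] by (simp add: binomial_term_def add.commute)
  also have "\<dots> \<le> (\<Sum>k\<le>t. binomial_term t u s)"
    by (intro sum_mono binomial_term_le_mode assms)
  finally show ?thesis by (simp add: add.commute)
qed

text \<open>
  Both counts are compared through the same \<open>z\<close>, for which \<open>4 * z\<close> is the odds \<open>p / (t - p)\<close>.
  The best density \<open>p / t\<close> would give the base \<open>sqrt 5 - 1\<close> in place of 1.159.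
\<close>

lemma monomials_words_ratio:
  assumes "0 < p" "p < t" and lo: "31 / 100 * real t \<le> p" and hi: "p \<le> 7 / 10 * real t"
  shows "1.159 ^ t * real (card (monomials t (p - 1))) \<le> (real t + 1) * real (card (words t p))"
proof -
  define z where "z = real p / (4 * (real t - real p))"
  have "0 < real t - real p" using assms by simp
  then have z_bounds: "31 / 276 \<le> z" "z \<le> 7 / 12"
    using lo hi by (simp_all add: z_def field_simps)
  then have z: "0 < z" "z \<le> 1" by auto
  have base: "1.159 * (1 + 2 * z + 2 * z\<^sup>2) \<le> 1 + 4 * z"
  proof -
    have "(z - 31 / 276) * (z - 7 / 12) \<le> 0" using z_bounds by (intro mult_nonneg_nonpos) auto
    moreover have "(z - a) * (z - b) = z\<^sup>2 - (a + b) * z + a * b" for a b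
      by (simp add: power2_eq_square algebra_simps)
    ultimately have "z\<^sup>2 - (31 / 276 + 7 / 12) * z + 31 / 276 * (7 / 12) \<le> 0" by simp
    then show ?thesis using z_bounds by simp
  qed
  have "1.159 ^ t * real (card (monomials t (p - 1))) * z ^ p
      \<le> 1.159 ^ t * (real (card (monomials t (p - 1))) * z ^ (p - 1))"
    unfolding mult.assoc using z by (intro mult_left_mono power_decreasing) auto
  also have "\<dots> \<le> 1.159 ^ t * (1 + 2 * z + 2 * z\<^sup>2) ^ t"
    using card_monomials_le[OF z] by (intro mult_left_mono) auto
  also have "\<dots> = (1.159 * (1 + 2 * z + 2 * z\<^sup>2)) ^ t" by (simp only: power_mult_distrib)
  also have "\<dots> \<le> (1 + 4 * z) ^ t" using base z by (intro power_mono) auto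
  also have "\<dots> \<le> (real t + 1) * binomial_term t (4 * z) p"
    using z \<open>0 < real t - real p\<close>
    by (intro binomial_power_le_mode) (simp_all add: z_def field_simps)
  also have "\<dots> = (real t + 1) * real (card (words t p)) * z ^ p"
    by (simp add: binomial_term_def card_words power_mult_distrib)
  finally show ?thesis using z by simp
qed

lemma eventually_power_1074_less_power_1159:
  "\<forall>\<^sub>F t::nat in sequentially. 8 * 1.074 ^ (2 * t + 1) * (real t + 1) < 1.159 ^ t"
proof -
  have "(1.074::real) ^ (2 * t + 1) = (1153476 / 1000000) ^ t * (1074 / 1000)" for t :: nat
    by (simp add: power_add power_mult power2_eq_square)
  moreover have "\<forall>\<^sub>F t::nat in sequentially.
      8 * ((1153476 / 1000000) ^ t * (1074 / 1000)) * (real t + 1) < (1159 / 1000) ^ t"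
    by real_asymp
  ultimately show ?thesis by simp
qed

lemma eventually_many_words:
  "\<forall>\<^sub>F t in sequentially. \<exists>p. prime p \<and> odd p \<and> p < t \<and>
     (\<forall>k. real k \<le> 1.074 ^ (2 * t + 1) \<longrightarrow> 8 * k * card (monomials t (p - 1)) < card (words t p))"
proof -
  have "\<forall>\<^sub>F t::nat in sequentially. \<exists>p. prime p \<and> 31 / 100 * t < real p \<and> real p \<le> 7 / 10 * t"
    by (rule eventually_exists_prime_between) auto
  then show ?thesis
    using eventually_power_1074_less_power_1159 eventually_ge_at_top[of 10]
  proof eventually_elim
    case (elim t)
    then obtain p :: nat where p: "prime p" "31 / 100 * t < real p" "real p \<le> 7 / 10 * t" by blast
    have "odd p" using p elim(3) by (intro prime_odd_nat) linarith+
    have "0 < p" "p < t" using p elim(3) prime_gt_0_nat by auto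
    define N where "N = card (monomials t (p - 1))"
    have "0 < N"
      using constant_monomial[of t "p - 1"] finite_monomials by (auto simp: N_def card_gt_0_iff)
    have "8 * k * N < card (words t p)" if k: "real k \<le> 1.074 ^ (2 * t + 1)" for k
    proof -
      have "(real t + 1) * real (8 * k * N) = 8 * real k * (real t + 1) * real N" by simp
      also have "\<dots> \<le> 8 * 1.074 ^ (2 * t + 1) * (real t + 1) * real N"
        using k by (intro mult_right_mono mult_left_mono) auto
      also have "\<dots> < 1.159 ^ t * real N"
        using elim(2) \<open>0 < N\<close> by (intro mult_strict_right_mono) auto
      also have "\<dots> \<le> (real t + 1) * real (card (words t p))"
        using p \<open>0 < p\<close> \<open>p < t\<close> unfolding N_def by (intro monomials_words_ratio) auto
      finally have "real (8 * k * N) < real (card (words t p))"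
        by (simp add: mult_less_cancel_left)
      then show ?thesis by (simp only: of_nat_less_iff)
    qed
    then show ?case using p(1) \<open>odd p\<close> \<open>p < t\<close> unfolding N_def by blast
  qed
qed

section \<open>Graphs of large girth and bounded degree\<close>

definition add_edge :: "'v \<Rightarrow> 'v \<Rightarrow> ('v \<times> 'v) set \<Rightarrow> ('v \<times> 'v) set" where
  "add_edge a b E = E \<union> {(a, b), (b, a)}"

lemma card_add_edge_le: "card (add_edge a b E) \<le> card E + 2"
proof -
  have "card (add_edge a b E) \<le> card E + card {(a, b), (b, a)}"
    unfolding add_edge_def by (rule card_Un_le)
  moreover have "card {(a, b), (b, a)} \<le> 2" by (simp add: card_insert_le_m1)
  ultimately show ?thesis by linarith
qed

lemma simple_graph_add_edge:
  assumes "simple_graph V E" "a \<in> V" "b \<in> V" "a \<noteq> b"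
  shows "simple_graph V (add_edge a b E)"
  using assms by (auto simp: simple_graph_def add_edge_def)

lemma sym_relpow:
  assumes "sym E" "(u, v) \<in> E ^^ n"
  shows "(v, u) \<in> E ^^ n"
  using assms(2)
proof (induction n arbitrary: v)
  case (Suc n)
  then obtain w where "(u, w) \<in> E ^^ n" "(w, v) \<in> E" by (elim relpow_Suc_E)
  then show ?case using Suc.IH \<open>sym E\<close> by (meson relpow_Suc_I2 symD)
qed simp

lemma is_cycle_rotate:
  assumes "is_cycle V E xs"
  shows "is_cycle V E (rotate n xs)"
proof -
  have "(rotate n xs ! i, rotate n xs ! ((i + 1) mod length xs)) \<in> E" if "i < length xs" for i
  proof -
    have "(n + i) mod length xs < length xs" "(i + 1) mod length xs < length xs"
      using that by (intro mod_less_divisor; linarith)+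
    then show ?thesis
      using assms that by (fastforce simp: is_cycle_def nth_rotate mod_simps add.assoc)
  qed
  then show ?thesis using assms by (simp add: is_cycle_def)
qed

lemma cycle_through_new_edge:
  assumes cycle: "is_cycle V (add_edge a b E) xs" and new: "\<not> is_cycle V E xs"
  obtains ys where "is_cycle V (add_edge a b E) ys" "length ys = length xs"
    "{hd ys, last ys} = {a, b}"
proof -
  let ?l = "length xs"
  have l: "?l \<ge> 3" using cycle by (simp add: is_cycle_def)
  obtain i where i: "i < ?l" "(xs ! i, xs ! ((i + 1) mod ?l)) \<notin> E"
    using cycle new by (auto simp: is_cycle_def)
  define ys where "ys = rotate (i + 1) xs"
  have "ys \<noteq> []" "length ys = ?l" using l by (auto simp: ys_def)
  have "hd ys = xs ! ((i + 1) mod ?l)"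
    using \<open>ys \<noteq> []\<close> l by (simp add: ys_def hd_conv_nth nth_rotate del: rotate_Suc)
  moreover have "last ys = xs ! i"
    using \<open>ys \<noteq> []\<close> l i(1) by (simp add: ys_def last_conv_nth nth_rotate del: rotate_Suc)
  moreover have "(xs ! i, xs ! ((i + 1) mod ?l)) \<in> {(a, b), (b, a)}"
    using cycle i by (auto simp: is_cycle_def add_edge_def)
  ultimately have "{hd ys, last ys} = {a, b}" by auto
  then show thesis
    using that cycle is_cycle_rotate \<open>length ys = ?l\<close> unfolding ys_def by blast
qed

lemma path_avoiding_new_edge:
  assumes cycle: "is_cycle V (add_edge a b E) ys" and ends: "{hd ys, last ys} = {a, b}"
  shows "(hd ys, last ys) \<in> E ^^ (length ys - 1)"
proof -
  let ?l = "length ys"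
  have l: "?l \<ge> 3" and "distinct ys" using cycle by (auto simp: is_cycle_def)
  then have "ys \<noteq> []" by auto
  then have hd: "hd ys = ys ! 0" and last: "last ys = ys ! (?l - 1)"
    by (simp_all add: hd_conv_nth last_conv_nth)
  have "(ys ! j, ys ! Suc j) \<in> E" if j: "j < ?l - 1" for j
  proof -
    have "(ys ! j, ys ! Suc j) \<in> add_edge a b E"
      using cycle j by (auto simp: is_cycle_def dest!: spec[of _ j])
    moreover have "{ys ! j, ys ! Suc j} \<noteq> {ys ! 0, ys ! (?l - 1)}"
    proof -
      have "ys ! i = ys ! i' \<longleftrightarrow> i = i'" if "i < ?l" "i' < ?l" for i i'
        using that \<open>distinct ys\<close> by (rule nth_eq_iff_index_eq[rotated])
      moreover have "j < ?l" "Suc j < ?l" "0 < ?l" "?l - 1 < ?l" using j by linarith+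
      ultimately show ?thesis using l j by (auto simp: doubleton_eq_iff)
    qed
    ultimately show ?thesis
      using ends by (auto simp: hd last add_edge_def)
  qed
  then show ?thesis
    unfolding relpow_fun_conv hd last by (intro exI[of _ "(!) ys"]) auto
qed

lemma girth_at_least_add_edge:
  assumes E: "simple_graph V E" and girth: "girth_at_least g V E"
    and far: "\<And>n. 1 \<le> n \<Longrightarrow> n < g - 1 \<Longrightarrow> (a, b) \<notin> E ^^ n"
  shows "girth_at_least g V (add_edge a b E)"
  unfolding girth_at_least_def
proof (intro allI impI)
  fix xs assume cycle: "is_cycle V (add_edge a b E) xs"
  show "g \<le> length xs"
  proof (cases "is_cycle V E xs")
    case True
    then show ?thesis using girth by (simp add: girth_at_least_def)
  next
    case False
    with cycle obtain ys where ys: "is_cycle V (add_edge a b E) ys" "length ys = length xs"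
        "{hd ys, last ys} = {a, b}"
      by (rule cycle_through_new_edge)
    have "sym E" using E by (auto simp: simple_graph_def sym_def)
    have "(hd ys, last ys) \<in> E ^^ (length xs - 1)"
      using path_avoiding_new_edge[OF ys(1,3)] ys(2) by simp
    then have "(a, b) \<in> E ^^ (length xs - 1)"
      using ys(3) sym_relpow[OF \<open>sym E\<close>] by (auto simp: doubleton_eq_iff)
    moreover have "length xs \<ge> 3" using cycle by (simp add: is_cycle_def)
    ultimately show ?thesis using far[of "length xs - 1"] by linarith
  qed
qed

lemma girth_at_least_empty: "girth_at_least g V {}"
  unfolding girth_at_least_def is_cycle_def by fastforce

definition sparse_graph :: "nat \<Rightarrow> nat \<Rightarrow> nat set \<Rightarrow> (nat \<times> nat) set \<Rightarrow> bool" where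
  "sparse_graph g \<Delta> V E \<longleftrightarrow>
     simple_graph V E \<and> girth_at_least g V E \<and> (\<forall>v. card (E `` {v}) \<le> \<Delta>)"

lemma finite_edges:
  assumes "simple_graph V E" "finite V"
  shows "finite E"
  using assms by (auto simp: simple_graph_def intro: finite_subset)

lemma sparse_graph_add_edge:
  assumes E: "sparse_graph g \<Delta> V E" and ab: "a \<in> V" "b \<in> V" "a \<noteq> b"
    and deg: "card (E `` {a}) < \<Delta>" "card (E `` {b}) < \<Delta>"
    and far: "\<And>n. 1 \<le> n \<Longrightarrow> n < g - 1 \<Longrightarrow> (a, b) \<notin> E ^^ n"
  shows "sparse_graph g \<Delta> V (add_edge a b E)"
proof -
  have simple: "simple_graph V E" and girth: "girth_at_least g V E" and "card (E `` {v}) \<le> \<Delta>" for v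
    using E by (auto simp: sparse_graph_def)
  have "card (add_edge a b E `` {v}) \<le> \<Delta>" for v
  proof -
    have "add_edge a b E `` {v} =
        (if v = a then insert b (E `` {v}) else if v = b then insert a (E `` {v}) else E `` {v})"
      using ab(3) by (auto simp: add_edge_def)
    then show ?thesis
      using deg \<open>card (E `` {v}) \<le> \<Delta>\<close> card_insert_le_m1[of \<Delta> "E `` {v}"] by auto
  qed
  then show ?thesis
    using simple_graph_add_edge[OF simple ab] girth_at_least_add_edge[OF simple girth far]
    by (simp add: sparse_graph_def)
qed

section \<open>Neighbourhoods and averaging\<close>

lemma card_UN_le_mult:
  assumes "finite I" "\<And>i. i \<in> I \<Longrightarrow> card (A i) \<le> n"
  shows "card (\<Union>i\<in>I. A i) \<le> card I * n"
  using card_UN_le[OF assms(1), of A] sum_bounded_above[of I "\<lambda>i. card (A i)" n] assms(2) by simp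

lemma finite_card_relpow_Image_le:
  fixes E :: "('a \<times> 'a) set"
  assumes "finite E" "\<And>v. card (E `` {v}) \<le> \<Delta>"
  shows "finite ((E ^^ n) `` {v}) \<and> card ((E ^^ n) `` {v}) \<le> \<Delta> ^ n"
proof (induction n)
  case (Suc n)
  have ball: "(E ^^ Suc n) `` {v} = (\<Union>w\<in>(E ^^ n) `` {v}. E `` {w})" by auto
  have "card ((E ^^ Suc n) `` {v}) \<le> card ((E ^^ n) `` {v}) * \<Delta>"
    unfolding ball using Suc assms(2) by (intro card_UN_le_mult) auto
  also have "\<dots> \<le> \<Delta> ^ Suc n" using Suc by (simp add: mult.commute)
  finally have "card ((E ^^ Suc n) `` {v}) \<le> \<Delta> ^ Suc n" .
  moreover have "finite ((E ^^ Suc n) `` {v})"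
    unfolding ball using Suc assms(1) by (auto intro: finite_Image)
  ultimately show ?case by blast
qed simp

definition close_pairs :: "nat \<Rightarrow> 'a set \<Rightarrow> ('a \<times> 'a) set \<Rightarrow> ('a \<times> 'a) set" where
  "close_pairs g V E = {(u, v). u \<in> V \<and> (\<exists>n\<in>{1..<g}. (u, v) \<in> E ^^ n)}"

lemma finite_card_close_pairs_le:
  assumes "finite V" "finite E" "\<And>v. card (E `` {v}) \<le> \<Delta>"
  shows "finite (close_pairs g V E) \<and> card (close_pairs g V E) \<le> card V * (\<Sum>n\<in>{1..<g}. \<Delta> ^ n)"
proof -
  have ball: "finite (\<Union>n\<in>{1..<g}. (E ^^ n) `` {u}) \<and>
      card (\<Union>n\<in>{1..<g}. (E ^^ n) `` {u}) \<le> (\<Sum>n\<in>{1..<g}. \<Delta> ^ n)" for u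
    using finite_card_relpow_Image_le[OF assms(2,3)]
    by (auto intro!: order_trans[OF card_UN_le sum_mono])
  have pairs: "close_pairs g V E = (SIGMA u:V. \<Union>n\<in>{1..<g}. (E ^^ n) `` {u})"
    by (auto simp: close_pairs_def)
  have "card (close_pairs g V E) = (\<Sum>u\<in>V. card (\<Union>n\<in>{1..<g}. (E ^^ n) `` {u}))"
    unfolding pairs using assms(1) ball by (intro card_SigmaI) auto
  also have "\<dots> \<le> card V * (\<Sum>n\<in>{1..<g}. \<Delta> ^ n)"
    using ball by (intro order_trans[OF sum_bounded_above]) auto
  finally show ?thesis using assms(1) ball by (auto simp: pairs)
qed

lemma card_saturated_le:
  assumes "finite V" "finite E"
  shows "card {v\<in>V. \<Delta> \<le> card (E `` {v})} * \<Delta> \<le> card E"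
proof -
  let ?S = "{v\<in>V. \<Delta> \<le> card (E `` {v})}"
  have "card ?S * \<Delta> \<le> (\<Sum>v\<in>?S. card (E `` {v}))"
    using sum_bounded_below[of ?S \<Delta> "\<lambda>v. card (E `` {v})"] by auto
  also have "\<dots> = card (SIGMA v:?S. E `` {v})"
    using assms finite_Image by simp
  also have "\<dots> \<le> card E" using assms by (intro card_mono) auto
  finally show ?thesis .
qed

lemma exists_popular_element:
  fixes h N :: nat
  assumes "finite A" "finite B" "A \<noteq> {}" "card B \<le> N" "0 < N"
    and popular: "\<And>a. a \<in> A \<Longrightarrow> N \<le> h * card {b\<in>B. R a b}"
  shows "\<exists>b\<in>B. card A \<le> h * card {a\<in>A. R a b}"
proof (rule ccontr)
  assume "\<not> ?thesis"
  then have unpopular: "h * card {a\<in>A. R a b} < card A" if "b \<in> B" for b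
    using that by (auto simp: not_le)
  have "B \<noteq> {}" using assms(3,5) popular by fastforce
  have "card A * N \<le> (\<Sum>a\<in>A. h * card {b\<in>B. R a b})"
    using sum_bounded_below[of A N "\<lambda>a. h * card {b\<in>B. R a b}"] popular by simp
  also have "\<dots> = h * (\<Sum>a\<in>A. card {b\<in>B. R a b})"
    by (simp add: sum_distrib_left)
  also have "(\<Sum>a\<in>A. card {b\<in>B. R a b}) = (\<Sum>b\<in>B. card {a\<in>A. R a b})"
    using assms(1,2) by (intro sum_multicount_gen) auto
  also have "h * \<dots> = (\<Sum>b\<in>B. h * card {a\<in>A. R a b})"
    by (rule sum_distrib_left)
  also have "\<dots> < (\<Sum>b\<in>B. card A)"
    using unpopular \<open>B \<noteq> {}\<close> assms(2) by (intro sum_strict_mono) auto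
  also have "\<dots> \<le> card A * N"
    using assms(4) by simp
  finally show False by simp
qed

section \<open>Colourings\<close>

definition colourings :: "nat set \<Rightarrow> (nat \<times> nat) set \<Rightarrow> nat \<Rightarrow> (nat \<Rightarrow> nat) set" where
  "colourings V E k = {c \<in> extensional V. proper_colouring V E c k}"

lemma colourings_no_edges: "colourings V {} k = V \<rightarrow>\<^sub>E {..<k}"
  by (auto simp: colourings_def proper_colouring_def PiE_def)

lemma colourings_subset: "colourings V E k \<subseteq> V \<rightarrow>\<^sub>E {..<k}"
  by (auto simp: colourings_def proper_colouring_def PiE_def)

lemma finite_colourings: "finite V \<Longrightarrow> finite (colourings V E k)"
  by (rule finite_subset[OF colourings_subset]) (auto intro: finite_PiE)

lemma colourings_add_edge:
  "colourings V (add_edge a b E) k = colourings V E k - {c \<in> colourings V E k. c a = c b}"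
  by (auto simp: colourings_def proper_colouring_def add_edge_def)

lemma not_colourable_if_colourings_empty:
  assumes "simple_graph V E" "colourings V E k = {}"
  shows "\<nexists>c. proper_colouring V E c k"
proof
  assume "\<exists>c. proper_colouring V E c k"
  then obtain c where "proper_colouring V E c k" ..
  moreover have "u \<in> V \<and> v \<in> V" if "(u, v) \<in> E" for u v
    using that assms(1) by (auto simp: simple_graph_def)
  ultimately have "restrict c V \<in> colourings V E k"
    by (fastforce simp: colourings_def proper_colouring_def)
  then show False using assms(2) by simp
qed

lemma less_chromatic_number:
  assumes "finite V" "simple_graph V E" and none: "\<nexists>c. proper_colouring V E c k"
  shows "k < chromatic_number V E"
proof (rule ccontr)
  assume "\<not> k < chromatic_number V E"
  obtain f :: "nat \<Rightarrow> nat" and n where "f ` V = {i. i < n}" "inj_on f V"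
    using finite_imp_inj_to_nat_seg[OF assms(1)] by blast
  then have "proper_colouring V E f n"
    using assms(2) unfolding proper_colouring_def simple_graph_def by (auto dest: inj_onD)
  then have "\<exists>c. proper_colouring V E c (chromatic_number V E)"
    unfolding chromatic_number_def by (intro LeastI_ex[of "\<lambda>k. \<exists>c. proper_colouring V E c k"]) blast
  then obtain c where "proper_colouring V E c (chromatic_number V E)" ..
  then have "proper_colouring V E c k"
    using \<open>\<not> k < chromatic_number V E\<close> unfolding proper_colouring_def by fastforce
  then show False using none by blast
qed

section \<open>Greedy sparsification\<close>

definition edge_graph :: "'q set \<Rightarrow> ('q \<Rightarrow> 'v) \<Rightarrow> ('q \<Rightarrow> 'v) \<Rightarrow> ('v \<times> 'v) set" where
  "edge_graph Q l r = {(u, v). \<exists>q\<in>Q. {u, v} = {l q, r q}}"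

text \<open>
  A multigraph with edges \<open>q \<in> Q\<close> from \<open>l q\<close> to \<open>r q\<close>, in which every colouring with \<open>k\<close> colours
  makes at least the fraction \<open>1 / h\<close> of the edges monochromatic.
\<close>

locale edge_family =
  fixes V :: "'v set" and Q :: "'q set" and l r :: "'q \<Rightarrow> 'v" and k h D M :: nat
  assumes finite_V: "finite V" and finite_Q: "finite Q" and Q_nonempty: "Q \<noteq> {}"
    and ends: "q \<in> Q \<Longrightarrow> l q \<in> V \<and> r q \<in> V \<and> l q \<noteq> r q"
    and monochromatic: "c ` V \<subseteq> {..<k} \<Longrightarrow> card Q \<le> h * card {q\<in>Q. c (l q) = c (r q)}"
    and degree: "card {q\<in>Q. l q = u \<or> r q = u} \<le> D"
    and multiplicity: "card {q\<in>Q. l q = u \<and> r q = v} \<le> M"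
begin

lemma V_nonempty: "V \<noteq> {}"
  using Q_nonempty ends by blast

lemma card_Q_pos: "0 < card Q"
  using finite_Q Q_nonempty by (simp add: card_gt_0_iff)

definition admissible :: "nat \<Rightarrow> nat \<Rightarrow> ('v \<times> 'v) set \<Rightarrow> 'q set" where
  "admissible g \<Delta> E = {q\<in>Q. card (E `` {l q}) < \<Delta> \<and> card (E `` {r q}) < \<Delta> \<and>
     (\<forall>n\<in>{1..<g - 1}. (l q, r q) \<notin> E ^^ n)}"

lemma card_incident_le:
  assumes "finite S"
  shows "card {q\<in>Q. l q \<in> S \<or> r q \<in> S} \<le> card S * D"
proof -
  have "{q\<in>Q. l q \<in> S \<or> r q \<in> S} = (\<Union>u\<in>S. {q\<in>Q. l q = u \<or> r q = u})" by auto
  then show ?thesis using card_UN_le_mult[OF assms degree] by simp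
qed

lemma card_between_le:
  assumes "finite P"
  shows "card {q\<in>Q. (l q, r q) \<in> P} \<le> card P * M"
proof -
  have "{q\<in>Q. (l q, r q) \<in> P} = (\<Union>e\<in>P. {q\<in>Q. l q = fst e \<and> r q = snd e})" by auto
  then show ?thesis using card_UN_le_mult[OF assms multiplicity] by simp
qed

lemma few_inadmissible:
  assumes E: "finite E" "\<And>v. card (E `` {v}) \<le> \<Delta>" "card E \<le> 2 * n" and "0 < \<Delta>"
    and saturated: "8 * h * n * D \<le> \<Delta> * card Q"
    and close: "4 * h * (card V * (\<Sum>i\<in>{1..<g - 1}. \<Delta> ^ i) * M) \<le> card Q"
  shows "2 * h * card (Q - admissible g \<Delta> E) \<le> card Q"
proof -
  define S where "S = {v\<in>V. \<Delta> \<le> card (E `` {v})}"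
  define P where "P = close_pairs (g - 1) V E"
  have P: "finite P" "card P \<le> card V * (\<Sum>i\<in>{1..<g - 1}. \<Delta> ^ i)"
    using finite_card_close_pairs_le[OF finite_V E(1,2)] by (auto simp: P_def)
  have "finite S" using finite_V by (simp add: S_def)
  have "\<Delta> * (4 * h * card {q\<in>Q. l q \<in> S \<or> r q \<in> S}) \<le> 4 * h * D * (card S * \<Delta>)"
    using card_incident_le[OF \<open>finite S\<close>] by (simp add: ac_simps)
  also have "\<dots> \<le> 4 * h * D * (2 * n)"
    using card_saturated_le[OF finite_V E(1), of \<Delta>] E(3)
    by (intro mult_left_mono) (auto simp: S_def)
  also have "\<dots> \<le> \<Delta> * card Q" using saturated by (simp add: ac_simps)
  finally have incident: "4 * h * card {q\<in>Q. l q \<in> S \<or> r q \<in> S} \<le> card Q"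
    using \<open>0 < \<Delta>\<close> by (simp only: mult_le_cancel1)
  have "card {q\<in>Q. (l q, r q) \<in> P} \<le> card V * (\<Sum>i\<in>{1..<g - 1}. \<Delta> ^ i) * M"
    by (rule order_trans[OF card_between_le[OF P(1)] mult_right_mono[OF P(2)]]) simp
  then have between: "4 * h * card {q\<in>Q. (l q, r q) \<in> P} \<le> card Q"
    by (rule order_trans[OF mult_left_mono close]) simp
  have "Q - admissible g \<Delta> E \<subseteq> {q\<in>Q. l q \<in> S \<or> r q \<in> S} \<union> {q\<in>Q. (l q, r q) \<in> P}"
    using ends by (auto simp: admissible_def S_def P_def close_pairs_def)
  then have "card (Q - admissible g \<Delta> E)
      \<le> card {q\<in>Q. l q \<in> S \<or> r q \<in> S} + card {q\<in>Q. (l q, r q) \<in> P}"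
    using finite_Q by (intro order_trans[OF card_mono card_Un_le]) auto
  from mult_left_mono[OF this, of "4 * h"] show ?thesis
    using incident between by (simp add: distrib_left)
qed

lemma exists_destructive_edge:
  assumes few: "2 * h * card (Q - R) \<le> card Q" and "R \<subseteq> Q" and "finite C" "C \<noteq> {}"
    and C: "\<And>c. c \<in> C \<Longrightarrow> c ` V \<subseteq> {..<k}"
  shows "\<exists>q\<in>R. card C \<le> 2 * h * card {c\<in>C. c (l q) = c (r q)}"
proof -
  have monochromatic_R: "card Q \<le> 2 * h * card {q\<in>R. c (l q) = c (r q)}" if "c \<in> C" for c
  proof -
    have "{q\<in>Q. c (l q) = c (r q)} \<subseteq> {q\<in>R. c (l q) = c (r q)} \<union> (Q - R)" by auto
    then have "card {q\<in>Q. c (l q) = c (r q)} \<le> card {q\<in>R. c (l q) = c (r q)} + card (Q - R)"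
      using finite_Q \<open>R \<subseteq> Q\<close>
      by (intro order_trans[OF card_mono card_Un_le]) (auto intro: finite_subset)
    from mult_left_mono[OF this, of "2 * h"] show ?thesis
      using few monochromatic[OF C[OF that]] by (simp add: distrib_left)
  qed
  show ?thesis
  proof (rule exists_popular_element[OF \<open>finite C\<close> _ \<open>C \<noteq> {}\<close> _ card_Q_pos monochromatic_R])
    show "finite R" using finite_Q \<open>R \<subseteq> Q\<close> by (rule finite_subset[rotated])
    show "card R \<le> card Q" using finite_Q \<open>R \<subseteq> Q\<close> by (rule card_mono)
  qed
qed

end

lemma exists_destructive_sparse_edge:
  assumes "edge_family V Q l r k h D M" and "0 < h" "0 < \<Delta>"
    and saturated: "8 * h * n * D \<le> \<Delta> * card Q"
    and close: "4 * h * (card V * (\<Sum>i\<in>{1..<g - 1}. \<Delta> ^ i) * M) \<le> card Q"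
    and E: "sparse_graph g \<Delta> V E" "card E \<le> 2 * n" and "colourings V E k \<noteq> {}"
  obtains q where "q \<in> Q" "sparse_graph g \<Delta> V (add_edge (l q) (r q) E)"
    "card (colourings V (add_edge (l q) (r q) E) k)
      \<le> (1 - 1 / (2 * real h)) * card (colourings V E k)"
proof -
  interpret edge_family V Q l r k h D M by fact
  let ?C = "colourings V E k"
  have "finite E" using E(1) finite_V by (auto simp: sparse_graph_def intro: finite_edges)
  then have "2 * h * card (Q - admissible g \<Delta> E) \<le> card Q"
    using E \<open>0 < \<Delta>\<close> saturated close by (intro few_inadmissible) (auto simp: sparse_graph_def)
  then have "\<exists>q\<in>admissible g \<Delta> E. card ?C \<le> 2 * h * card {c\<in>?C. c (l q) = c (r q)}"
    using \<open>?C \<noteq> {}\<close> finite_V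
    by (intro exists_destructive_edge finite_colourings)
      (auto simp: admissible_def colourings_def proper_colouring_def)
  then obtain q where q: "q \<in> admissible g \<Delta> E"
    and destroyed: "card ?C \<le> 2 * h * card {c\<in>?C. c (l q) = c (r q)}"
    by blast
  have "q \<in> Q" using q by (simp add: admissible_def)
  moreover have "sparse_graph g \<Delta> V (add_edge (l q) (r q) E)"
    using q ends[OF \<open>q \<in> Q\<close>] E(1) by (intro sparse_graph_add_edge) (auto simp: admissible_def)
  moreover have "card (colourings V (add_edge (l q) (r q) E) k) \<le> (1 - 1 / (2 * real h)) * card ?C"
  proof -
    have "real (card ?C) \<le> real (2 * h * card {c\<in>?C. c (l q) = c (r q)})"
      using destroyed by (simp only: of_nat_le_iff)
    then have "card ?C / (2 * real h) \<le> real (card {c\<in>?C. c (l q) = c (r q)})"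
      using \<open>0 < h\<close> by (simp add: field_simps)
    moreover have "real (card (colourings V (add_edge (l q) (r q) E) k))
        = card ?C - real (card {c\<in>?C. c (l q) = c (r q)})"
      unfolding colourings_add_edge using finite_colourings[OF finite_V]
      by (simp add: card_Diff_subset card_mono of_nat_diff)
    ultimately show ?thesis by (simp add: left_diff_distrib)
  qed
  ultimately show thesis by (rule that)
qed

lemma sparse_greedy_step:
  assumes "edge_family V Q l r k h D M" and "0 < h" "0 < \<Delta>"
    and "8 * h * n * D \<le> \<Delta> * card Q"
    and "4 * h * (card V * (\<Sum>i\<in>{1..<g - 1}. \<Delta> ^ i) * M) \<le> card Q"
    and E: "sparse_graph g \<Delta> V E" "card E \<le> 2 * n" "E \<subseteq> edge_graph Q l r"
  shows "\<exists>E'. sparse_graph g \<Delta> V E' \<and> E' \<subseteq> edge_graph Q l r \<and> card E' \<le> card E + 2 \<and>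
    card (colourings V E' k) \<le> (1 - 1 / (2 * real h)) * card (colourings V E k)"
proof (cases "colourings V E k = {}")
  case True
  then show ?thesis using E \<open>0 < h\<close> by (intro exI[of _ E]) simp
next
  case False
  with assms(1-5) E(1,2) obtain q where "q \<in> Q" and q: "sparse_graph g \<Delta> V (add_edge (l q) (r q) E)"
    "card (colourings V (add_edge (l q) (r q) E) k)
      \<le> (1 - 1 / (2 * real h)) * card (colourings V E k)"
    by (rule exists_destructive_sparse_edge)
  have "add_edge (l q) (r q) E \<subseteq> edge_graph Q l r"
    using E(3) \<open>q \<in> Q\<close> by (auto simp: add_edge_def edge_graph_def)
  then show ?thesis
    using q by (intro exI[of _ "add_edge (l q) (r q) E"] conjI card_add_edge_le)
qed

lemma sparse_greedy:
  assumes family: "edge_family V Q l r k h D M" and "0 < h" "0 < \<Delta>"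
    and saturated: "8 * h * n * D \<le> \<Delta> * card Q"
    and close: "4 * h * (card V * (\<Sum>i\<in>{1..<g - 1}. \<Delta> ^ i) * M) \<le> card Q"
    and "j \<le> n"
  shows "\<exists>E. sparse_graph g \<Delta> V E \<and> E \<subseteq> edge_graph Q l r \<and> card E \<le> 2 * j \<and>
    card (colourings V E k) \<le> (1 - 1 / (2 * real h)) ^ j * real (k ^ card V)"
  using \<open>j \<le> n\<close>
proof (induction j)
  case 0
  have "finite V" using family by (rule edge_family.finite_V)
  then have "card (colourings V {} k) = k ^ card V"
    by (simp add: colourings_no_edges card_PiE)
  then show ?case
    by (intro exI[of _ "{}"]) (auto simp: sparse_graph_def simple_graph_def girth_at_least_empty)
next
  case (Suc j)
  let ?\<rho> = "1 - 1 / (2 * real h)"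
  obtain E where E: "sparse_graph g \<Delta> V E" "E \<subseteq> edge_graph Q l r" "card E \<le> 2 * j"
      "card (colourings V E k) \<le> ?\<rho> ^ j * real (k ^ card V)"
    using Suc by auto
  have "card E \<le> 2 * n" using E(3) Suc.prems by simp
  from sparse_greedy_step[OF family \<open>0 < h\<close> \<open>0 < \<Delta>\<close> saturated close E(1) this E(2)]
  obtain E' where E': "sparse_graph g \<Delta> V E'" "E' \<subseteq> edge_graph Q l r" "card E' \<le> card E + 2"
      "card (colourings V E' k) \<le> ?\<rho> * card (colourings V E k)"
    by blast
  have "0 \<le> ?\<rho>" using \<open>0 < h\<close> by simp
  then have "?\<rho> * card (colourings V E k) \<le> ?\<rho> ^ Suc j * real (k ^ card V)"
    using mult_left_mono[OF E(4)] by (simp add: mult.assoc)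
  then have "card (colourings V E' k) \<le> ?\<rho> ^ Suc j * real (k ^ card V)"
    using E'(4) by linarith
  moreover have "card E' \<le> 2 * Suc j" using E(3) E'(3) by simp
  ultimately show ?case using E'(1,2) by blast
qed

lemma power_mult_power_less_one:
  fixes \<rho> x :: real
  assumes "0 \<le> \<rho>" "0 \<le> x" "\<rho> ^ C * x < 1" "0 < n"
  shows "\<rho> ^ (C * n) * x ^ n < 1"
proof -
  have "\<rho> ^ (C * n) * x ^ n = (\<rho> ^ C * x) ^ n" by (simp add: power_mult power_mult_distrib)
  then show ?thesis using assms by (simp add: power_less_one_iff)
qed

lemma exists_sparse_graph_uncolourable:
  assumes family: "edge_family V Q l r k h D M" and "0 < h" "0 < \<Delta>"
    and C: "(1 - 1 / (2 * real h)) ^ C * real k < 1"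
    and saturated: "8 * h * (C * card V) * D \<le> \<Delta> * card Q"
    and close: "4 * h * (card V * (\<Sum>i\<in>{1..<g - 1}. \<Delta> ^ i) * M) \<le> card Q"
  shows "\<exists>E. sparse_graph g \<Delta> V E \<and> E \<subseteq> edge_graph Q l r \<and> k < chromatic_number V E"
proof -
  interpret edge_family V Q l r k h D M by fact
  let ?\<rho> = "1 - 1 / (2 * real h)"
  obtain E where E: "sparse_graph g \<Delta> V E" "E \<subseteq> edge_graph Q l r"
      "card (colourings V E k) \<le> ?\<rho> ^ (C * card V) * real (k ^ card V)"
    using sparse_greedy[OF family \<open>0 < h\<close> \<open>0 < \<Delta>\<close> saturated close order_refl] by blast
  have "0 \<le> ?\<rho>" using \<open>0 < h\<close> by simp
  have "?\<rho> ^ (C * card V) * real (k ^ card V) < 1"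
    using power_mult_power_less_one[OF \<open>0 \<le> ?\<rho>\<close> _ C, of "card V"] finite_V V_nonempty
    by (simp add: card_gt_0_iff)
  with E(3) have "card (colourings V E k) = 0" by linarith
  then have "colourings V E k = {}" using finite_colourings[OF finite_V] by simp
  moreover have "simple_graph V E" using E(1) by (simp add: sparse_graph_def)
  ultimately have "k < chromatic_number V E"
    using finite_V by (intro less_chromatic_number not_colourable_if_colourings_empty)
  then show ?thesis using E(1,2) by blast
qed

text \<open>
  The hypotheses on \<open>card V\<close> bound the maximal degree by a constant times the average degree,
  and require the edge multiplicities to be small compared to the average degree.
\<close>

lemma exists_sparse_uncolourable_subgraph:
  fixes g k h A :: nat
  assumes "0 < h"
  obtains B where "\<And>V (Q :: 'q set) l r D M. edge_family V Q l r k h D M \<Longrightarrow>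
      card V * D \<le> A * card Q \<Longrightarrow> B * (card V * M) \<le> card Q \<Longrightarrow>
      \<exists>E. simple_graph V E \<and> girth_at_least g V E \<and> E \<subseteq> edge_graph Q l r \<and> k < chromatic_number V E"
proof -
  let ?\<rho> = "1 - 1 / (2 * real h)"
  have \<rho>: "0 \<le> ?\<rho>" "?\<rho> < 1" using \<open>0 < h\<close> by simp_all
  obtain C where "?\<rho> ^ C < 1 / (real k + 1)"
    using real_arch_pow_inv[of "1 / (real k + 1)" ?\<rho>] \<rho> by auto
  then have "?\<rho> ^ C * (real k + 1) < 1" by (simp add: field_simps)
  moreover have "?\<rho> ^ C * real k \<le> ?\<rho> ^ C * (real k + 1)" using \<rho> by (intro mult_left_mono) auto
  ultimately have C: "?\<rho> ^ C * real k < 1" by linarith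
  define \<Delta> where "\<Delta> = 8 * h * C * A + 1"
  define B where "B = 4 * h * (\<Sum>i\<in>{1..<g - 1}. \<Delta> ^ i)"
  show thesis
  proof (rule that[of B])
    fix V :: "nat set" and Q :: "'q set" and l r D M
    assume family: "edge_family V Q l r k h D M"
      and D: "card V * D \<le> A * card Q" and M: "B * (card V * M) \<le> card Q"
    have "8 * h * (C * card V) * D = 8 * h * C * (card V * D)" by simp
    also have "\<dots> \<le> 8 * h * C * (A * card Q)" using D by (rule mult_left_mono) simp
    also have "\<dots> \<le> \<Delta> * card Q" by (simp add: \<Delta>_def algebra_simps)
    finally have "8 * h * (C * card V) * D \<le> \<Delta> * card Q" .
    moreover have "4 * h * (card V * (\<Sum>i\<in>{1..<g - 1}. \<Delta> ^ i) * M) \<le> card Q"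
      using M by (simp add: B_def ac_simps)
    ultimately show "\<exists>E. simple_graph V E \<and> girth_at_least g V E \<and> E \<subseteq> edge_graph Q l r \<and>
        k < chromatic_number V E"
      using exists_sparse_graph_uncolourable[OF family \<open>0 < h\<close> _ C, of \<Delta> g]
      by (auto simp: \<Delta>_def sparse_graph_def)
  qed
qed

section \<open>Orthogonality graphs on the sphere\<close>

lemma (in edge_family) edge_family_image:
  assumes inj: "inj_on \<phi> V"
  shows "edge_family (\<phi> ` V) Q (\<phi> \<circ> l) (\<phi> \<circ> r) k h D M"
proof
  fix q assume q: "q \<in> Q"
  have "\<phi> (l q) \<noteq> \<phi> (r q)" using ends[OF q] inj by (auto dest: inj_onD)
  then show "(\<phi> \<circ> l) q \<in> \<phi> ` V \<and> (\<phi> \<circ> r) q \<in> \<phi> ` V \<and> (\<phi> \<circ> l) q \<noteq> (\<phi> \<circ> r) q"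
    using ends[OF q] by simp
next
  show "card Q \<le> h * card {q\<in>Q. c ((\<phi> \<circ> l) q) = c ((\<phi> \<circ> r) q)}" if "c ` \<phi> ` V \<subseteq> {..<k}" for c
    using monochromatic[of "c \<circ> \<phi>"] that by (simp add: image_comp)
next
  have pull_back: "l q = inv_into V \<phi> (\<phi> (l q))" "r q = inv_into V \<phi> (\<phi> (r q))" if "q \<in> Q" for q
    using ends[OF that] inj by simp_all
  fix u v
  have "{q\<in>Q. (\<phi> \<circ> l) q = u \<or> (\<phi> \<circ> r) q = u} \<subseteq> {q\<in>Q. l q = inv_into V \<phi> u \<or> r q = inv_into V \<phi> u}"
    using pull_back by auto
  then show "card {q\<in>Q. (\<phi> \<circ> l) q = u \<or> (\<phi> \<circ> r) q = u} \<le> D"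
    using finite_Q by (intro order_trans[OF card_mono degree]) auto
  have "{q\<in>Q. (\<phi> \<circ> l) q = u \<and> (\<phi> \<circ> r) q = v} \<subseteq> {q\<in>Q. l q = inv_into V \<phi> u \<and> r q = inv_into V \<phi> v}"
    using pull_back by auto
  then show "card {q\<in>Q. (\<phi> \<circ> l) q = u \<and> (\<phi> \<circ> r) q = v} \<le> M"
    using finite_Q by (intro order_trans[OF card_mono multiplicity]) auto
qed (use finite_V finite_Q Q_nonempty in auto)

definition high_girth_orthogonality_graph :: "nat \<Rightarrow> nat \<Rightarrow> nat set \<Rightarrow> (nat \<times> nat) set \<Rightarrow> bool" where
  "high_girth_orthogonality_graph g d V E \<longleftrightarrow> finite V \<and> simple_graph V E \<and>
     orthogonality_graph_in d (unit_sphere d) V E \<and> girth_at_least g V E"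

lemma orthogonality_graph_in_edge_graph_image:
  assumes "edge_family S Q l r k h D M" and \<phi>: "inj_on \<phi> S" and "S \<subseteq> T"
    and orthogonal: "\<And>q. q \<in> Q \<Longrightarrow> inner_d d (l q) (r q) = 0"
    and E: "E \<subseteq> edge_graph Q (\<phi> \<circ> l) (\<phi> \<circ> r)"
  shows "orthogonality_graph_in d T (\<phi> ` S) E"
  unfolding orthogonality_graph_in_def
proof (intro exI conjI ballI)
  show "inj_on (inv_into S \<phi>) (\<phi> ` S)" by (rule inj_on_inv_into) simp
  show "inv_into S \<phi> ` \<phi> ` S \<subseteq> T"
    using \<phi> \<open>S \<subseteq> T\<close> by (simp add: inv_into_image_cancel)
  fix e assume "e \<in> E"
  then obtain u v q where e: "e = (u, v)" and q: "q \<in> Q" "{u, v} = {\<phi> (l q), \<phi> (r q)}"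
    using E by (auto simp: edge_graph_def)
  have "inv_into S \<phi> (\<phi> (l q)) = l q" "inv_into S \<phi> (\<phi> (r q)) = r q"
    using edge_family.ends[OF assms(1) q(1)] \<phi> by simp_all
  moreover have "inner_d d (l q) (r q) = 0" "inner_d d (r q) (l q) = 0"
    using orthogonal[OF q(1)] by (simp_all add: inner_d_def mult.commute)
  ultimately show "case e of (u, v) \<Rightarrow> inner_d d (inv_into S \<phi> u) (inv_into S \<phi> v) = 0"
    using q(2) by (auto simp: e doubleton_eq_iff)
qed

lemma exists_high_girth_orthogonality_graph:
  fixes g k h A :: nat
  assumes "0 < h"
  obtains B where "\<And>S (Q :: 'q set) l r D M d. edge_family S Q l r k h D M \<Longrightarrow>
      card S * D \<le> A * card Q \<Longrightarrow> B * (card S * M) \<le> card Q \<Longrightarrow>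
      S \<subseteq> unit_sphere d \<Longrightarrow> (\<And>q. q \<in> Q \<Longrightarrow> inner_d d (l q) (r q) = 0) \<Longrightarrow>
      \<exists>V E. high_girth_orthogonality_graph g d V E \<and> k < chromatic_number V E"
proof -
  obtain B where B: "\<And>V (Q :: 'q set) l r D M. edge_family V Q l r k h D M \<Longrightarrow>
      card V * D \<le> A * card Q \<Longrightarrow> B * (card V * M) \<le> card Q \<Longrightarrow>
      \<exists>E. simple_graph V E \<and> girth_at_least g V E \<and> E \<subseteq> edge_graph Q l r \<and> k < chromatic_number V E"
    using exists_sparse_uncolourable_subgraph[OF assms, where g = g and k = k and A = A] by blast
  show thesis
  proof (rule that[of B])
    fix S and Q :: "'q set" and l r D M d
    assume family: "edge_family S Q l r k h D M"
      and D: "card S * D \<le> A * card Q" and M: "B * (card S * M) \<le> card Q"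
      and S: "S \<subseteq> unit_sphere d" and orthogonal: "\<And>q. q \<in> Q \<Longrightarrow> inner_d d (l q) (r q) = 0"
    have "finite S" using family by (rule edge_family.finite_V)
    then obtain \<phi> :: "(nat \<Rightarrow> real) \<Rightarrow> nat" where \<phi>: "inj_on \<phi> S"
      using finite_imp_inj_to_nat_seg by blast
    from B[OF edge_family.edge_family_image[OF family \<phi>]] D M
    obtain E where E: "simple_graph (\<phi> ` S) E" "girth_at_least g (\<phi> ` S) E"
        "E \<subseteq> edge_graph Q (\<phi> \<circ> l) (\<phi> \<circ> r)" "k < chromatic_number (\<phi> ` S) E"
      by (auto simp: card_image[OF \<phi>])
    have "orthogonality_graph_in d (unit_sphere d) (\<phi> ` S) E"
      using family \<phi> S orthogonal E(3) by (rule orthogonality_graph_in_edge_graph_image)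
    then show "\<exists>V E. high_girth_orthogonality_graph g d V E \<and> k < chromatic_number V E"
      using E \<open>finite S\<close> by (auto simp: high_girth_orthogonality_graph_def)
  qed
qed

lemma high_girth_orthogonality_graph_singleton:
  assumes "0 < d"
  shows "high_girth_orthogonality_graph g d {0} {}"
proof -
  have "(\<lambda>i. if i = 0 then 1 else 0) \<in> unit_sphere d"
    using assms by (auto simp: unit_sphere_def inner_d_def if_distrib[of "\<lambda>u. u * _"] cong: if_cong)
  then have "orthogonality_graph_in d (unit_sphere d) {0} {}"
    unfolding orthogonality_graph_in_def by (intro exI[of _ "\<lambda>_ i. if i = 0 then 1 else 0"]) auto
  then show ?thesis
    by (simp add: high_girth_orthogonality_graph_def simple_graph_def girth_at_least_empty)
qed

section \<open>Rotated copies of the words\<close>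

definition rot_cos :: "nat \<Rightarrow> real" where
  "rot_cos i = 1 / (real i + 1)"

definition rot_sin :: "nat \<Rightarrow> real" where
  "rot_sin i = sqrt (1 - rot_cos i ^ 2)"

definition torus_point :: "nat \<Rightarrow> nat \<Rightarrow> word \<Rightarrow> (nat \<Rightarrow> nat) \<Rightarrow> nat \<Rightarrow> real" where
  "torus_point t p x \<theta> n =
     (let j = n div 2; a = of_int (fst (x j)); b = of_int (snd (x j));
          c = rot_cos (\<theta> j); s = rot_sin (\<theta> j)
      in if n < 2 * t then (if even n then a * c - b * s else a * s + b * c) / sqrt p else 0)"

lemma rot_cos_sin: "rot_cos i * rot_cos i + rot_sin i * rot_sin i = 1"
proof -
  have "rot_cos i ^ 2 \<le> 1" unfolding rot_cos_def by (intro power_le_one) auto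
  then have "rot_sin i ^ 2 = 1 - rot_cos i ^ 2" by (simp add: rot_sin_def)
  then show ?thesis by (simp add: power2_eq_square)
qed

lemma rot_cos_inject: "rot_cos i = rot_cos j \<longleftrightarrow> i = j"
  by (auto simp: rot_cos_def field_simps)

lemma sum_lessThan_double: "(\<Sum>i<2 * t. f i) = (\<Sum>j<t. f (2 * j) + f (2 * j + 1))"
  for f :: "nat \<Rightarrow> 'a::comm_monoid_add"
  by (induction t) (simp_all add: add.assoc)

lemma inner_rotate:
  fixes a b a' b' c s :: real
  assumes "c * c + s * s = 1"
  shows "(a * c - b * s) * (a' * c - b' * s) + (a * s + b * c) * (a' * s + b' * c)
    = a * a' + b * b'"
proof -
  have "(a * c - b * s) * (a' * c - b' * s) + (a * s + b * c) * (a' * s + b' * c)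
      = (a * a' + b * b') * (c * c + s * s)"
    by (simp add: algebra_simps)
  then show ?thesis by (simp add: assms)
qed

lemma inner_torus_point:
  assumes "2 * t \<le> d"
  shows "inner_d d (torus_point t p x \<theta>) (torus_point t p y \<theta>) = of_int (word_inner t x y) / p"
proof -
  have "inner_d d (torus_point t p x \<theta>) (torus_point t p y \<theta>)
      = (\<Sum>i<2 * t. torus_point t p x \<theta> i * torus_point t p y \<theta> i)"
    unfolding inner_d_def using assms by (intro sum.mono_neutral_right) (auto simp: torus_point_def)
  also have "\<dots> = (\<Sum>j<t. torus_point t p x \<theta> (2 * j) * torus_point t p y \<theta> (2 * j)
      + torus_point t p x \<theta> (2 * j + 1) * torus_point t p y \<theta> (2 * j + 1))"
    by (rule sum_lessThan_double)
  also have "\<dots> = (\<Sum>j<t. of_int (fst (x j) * fst (y j) + snd (x j) * snd (y j)) / p)"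
  proof (intro sum.cong refl)
    fix j assume "j \<in> {..<t}"
    then show "torus_point t p x \<theta> (2 * j) * torus_point t p y \<theta> (2 * j)
        + torus_point t p x \<theta> (2 * j + 1) * torus_point t p y \<theta> (2 * j + 1)
        = of_int (fst (x j) * fst (y j) + snd (x j) * snd (y j)) / p"
      by (simp add: torus_point_def Let_def inner_rotate[OF rot_cos_sin] flip: add_divide_distrib)
  qed
  finally show ?thesis by (simp add: word_inner_def sum_divide_distrib)
qed

lemma torus_point_in_sphere:
  assumes "x \<in> words t p" "2 * t \<le> d" "p > 0"
  shows "torus_point t p x \<theta> \<in> unit_sphere d"
  using assms inner_torus_point[of t d p x \<theta> x] word_inner_self[of x t p]
  by (auto simp: unit_sphere_def torus_point_def)

lemma torus_point_restrict: "torus_point t p x (restrict \<theta> (word_supp t x)) = torus_point t p x \<theta>"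
proof
  fix n
  have "x (n div 2) = (0, 0) \<or> n div 2 \<in> word_supp t x" if "n < 2 * t"
    using that by (auto simp: word_supp_def)
  then show "torus_point t p x (restrict \<theta> (word_supp t x)) n = torus_point t p x \<theta> n"
    by (auto simp: torus_point_def Let_def)
qed

lemma torus_point_eq_imp_angle_eq:
  assumes x: "x \<in> words t p" and "p > 0" and eq: "torus_point t p x \<theta> = torus_point t p x \<theta>'"
    and j: "j \<in> word_supp t x"
  shows "\<theta> j = \<theta>' j"
proof -
  have j': "j < t" "x j \<in> letters - {(0, 0)}" using j x by (auto simp: word_supp_def words_def)
  have "fst (x j) * rot_cos (\<theta> j) - snd (x j) * rot_sin (\<theta> j)
      = fst (x j) * rot_cos (\<theta>' j) - snd (x j) * rot_sin (\<theta>' j)"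
    using fun_cong[OF eq, of "2 * j"] j'(1) \<open>p > 0\<close> by (simp add: torus_point_def Let_def)
  moreover have "fst (x j) * rot_sin (\<theta> j) + snd (x j) * rot_cos (\<theta> j)
      = fst (x j) * rot_sin (\<theta>' j) + snd (x j) * rot_cos (\<theta>' j)"
    using fun_cong[OF eq, of "2 * j + 1"] j'(1) \<open>p > 0\<close> by (simp add: torus_point_def Let_def)
  ultimately have "rot_cos (\<theta> j) = rot_cos (\<theta>' j)" using j'(2) by (auto simp: letters_def)
  then show ?thesis by (simp add: rot_cos_inject)
qed

lemma card_le_if_agree_on:
  fixes F :: "('a \<Rightarrow> nat) set"
  assumes F: "F \<subseteq> T \<rightarrow>\<^sub>E {..<m}" and A: "A \<subseteq> T" and "finite T"
    and agree: "\<And>\<theta> \<theta>' j. \<theta> \<in> F \<Longrightarrow> \<theta>' \<in> F \<Longrightarrow> j \<in> A \<Longrightarrow> \<theta> j = \<theta>' j"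
  shows "card F \<le> m ^ (card T - card A)"
proof -
  have "inj_on (\<lambda>\<theta>. restrict \<theta> (T - A)) F"
  proof (rule inj_onI)
    fix \<theta> \<theta>' assume \<theta>: "\<theta> \<in> F" "\<theta>' \<in> F" and eq: "restrict \<theta> (T - A) = restrict \<theta>' (T - A)"
    show "\<theta> = \<theta>'"
    proof (rule PiE_ext)
      show "\<theta> \<in> T \<rightarrow>\<^sub>E {..<m}" "\<theta>' \<in> T \<rightarrow>\<^sub>E {..<m}" using \<theta> F by auto
      show "\<theta> j = \<theta>' j" if "j \<in> T" for j
        using that agree[OF \<theta>, of j] fun_cong[OF eq, of j] by (cases "j \<in> A") auto
    qed
  qed
  moreover have "(\<lambda>\<theta>. restrict \<theta> (T - A)) ` F \<subseteq> (T - A) \<rightarrow>\<^sub>E {..<m}"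
    using F by (auto simp: PiE_def Pi_def)
  ultimately have "card F \<le> card ((T - A) \<rightarrow>\<^sub>E {..<m})"
    using \<open>finite T\<close> by (intro card_inj_on_le) (auto intro!: finite_PiE)
  also have "\<dots> = m ^ (card T - card A)"
    using A \<open>finite T\<close> by (simp add: card_PiE card_Diff_subset finite_subset)
  finally show ?thesis .
qed

definition angles :: "nat \<Rightarrow> nat \<Rightarrow> (nat \<Rightarrow> nat) set" where
  "angles t m = {..<t} \<rightarrow>\<^sub>E {..<m}"

lemma finite_angles: "finite (angles t m)"
  by (auto simp: angles_def intro!: finite_PiE)

lemma card_angles: "card (angles t m) = m ^ t"
  by (simp add: angles_def card_PiE)

lemma card_torus_orbit_le:
  assumes x: "x \<in> words t p"
  shows "card (torus_point t p x ` angles t m) \<le> m ^ p"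
proof -
  let ?A = "word_supp t x"
  have fin: "finite (?A \<rightarrow>\<^sub>E {..<m})" by (intro finite_PiE finite_word_supp) auto
  have "torus_point t p x ` angles t m \<subseteq> torus_point t p x ` (?A \<rightarrow>\<^sub>E {..<m})"
  proof (rule image_subsetI)
    fix \<theta> assume "\<theta> \<in> angles t m"
    then have "restrict \<theta> ?A \<in> ?A \<rightarrow>\<^sub>E {..<m}" by (auto simp: angles_def word_supp_def)
    then show "torus_point t p x \<theta> \<in> torus_point t p x ` (?A \<rightarrow>\<^sub>E {..<m})"
      by (metis image_eqI torus_point_restrict)
  qed
  then have "card (torus_point t p x ` angles t m) \<le> card (?A \<rightarrow>\<^sub>E {..<m})"
    using fin by (intro order_trans[OF card_mono card_image_le]) auto
  also have "\<dots> = m ^ p" using x finite_word_supp by (simp add: card_PiE words_def)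
  finally show ?thesis .
qed

lemma card_torus_fibre_le:
  assumes X: "X \<subseteq> words t p" and "p > 0"
  shows "card {\<theta> \<in> angles t m. \<forall>x\<in>X. torus_point t p x \<theta> = v x}
    \<le> m ^ (t - card (\<Union>x\<in>X. word_supp t x))"
proof -
  let ?F = "{\<theta> \<in> angles t m. \<forall>x\<in>X. torus_point t p x \<theta> = v x}"
  have "card ?F \<le> m ^ (card {..<t} - card (\<Union>x\<in>X. word_supp t x))"
  proof (rule card_le_if_agree_on)
    fix \<theta> \<theta>' j assume \<theta>: "\<theta> \<in> ?F" "\<theta>' \<in> ?F" and "j \<in> (\<Union>x\<in>X. word_supp t x)"
    then obtain x where "x \<in> X" "j \<in> word_supp t x" by blast
    moreover have "torus_point t p x \<theta> = torus_point t p x \<theta>'" using \<theta> \<open>x \<in> X\<close> by simp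
    ultimately show "\<theta> j = \<theta>' j" using X \<open>p > 0\<close> torus_point_eq_imp_angle_eq by blast
  qed (auto simp: angles_def word_supp_def)
  then show ?thesis by simp
qed

type_synonym torus_edge = "(word \<times> word) \<times> (nat \<Rightarrow> nat)"

definition orthogonal_pairs :: "nat \<Rightarrow> nat \<Rightarrow> (word \<times> word) set" where
  "orthogonal_pairs t p =
     {(x, y). x \<in> words t p \<and> y \<in> words t p \<and> word_inner t x y = 0 \<and> word_supp t x \<noteq> word_supp t y}"

definition torus_vertices :: "nat \<Rightarrow> nat \<Rightarrow> nat \<Rightarrow> (nat \<Rightarrow> real) set" where
  "torus_vertices t p m = (\<Union>x\<in>words t p. torus_point t p x ` angles t m)"

definition torus_edges :: "nat \<Rightarrow> nat \<Rightarrow> nat \<Rightarrow> torus_edge set" where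
  "torus_edges t p m = orthogonal_pairs t p \<times> angles t m"

definition torus_left :: "nat \<Rightarrow> nat \<Rightarrow> torus_edge \<Rightarrow> nat \<Rightarrow> real" where
  "torus_left t p q = torus_point t p (fst (fst q)) (snd q)"

definition torus_right :: "nat \<Rightarrow> nat \<Rightarrow> torus_edge \<Rightarrow> nat \<Rightarrow> real" where
  "torus_right t p q = torus_point t p (snd (fst q)) (snd q)"

lemma finite_orthogonal_pairs: "finite (orthogonal_pairs t p)"
  by (rule finite_subset[of _ "words t p \<times> words t p"])
    (auto simp: orthogonal_pairs_def finite_words)

lemma finite_torus_vertices: "finite (torus_vertices t p m)"
  by (simp add: torus_vertices_def finite_words finite_angles)

lemma finite_torus_edges: "finite (torus_edges t p m)"
  by (simp add: torus_edges_def finite_orthogonal_pairs finite_angles)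

lemma card_torus_edges: "card (torus_edges t p m) = card (orthogonal_pairs t p) * m ^ t"
  by (simp add: torus_edges_def card_cartesian_product card_angles)

lemma card_torus_vertices_le: "card (torus_vertices t p m) \<le> card (words t p) * m ^ p"
  unfolding torus_vertices_def by (intro card_UN_le_mult finite_words card_torus_orbit_le)

lemma torus_edgesD:
  assumes "q \<in> torus_edges t p m"
  shows "fst (fst q) \<in> words t p" "snd (fst q) \<in> words t p"
    "word_inner t (fst (fst q)) (snd (fst q)) = 0" "snd q \<in> angles t m"
  using assms by (simp_all add: torus_edges_def orthogonal_pairs_def mem_Times_iff split_beta)

lemma torus_ends_in_vertices:
  assumes "q \<in> torus_edges t p m"
  shows "torus_left t p q \<in> torus_vertices t p m" "torus_right t p q \<in> torus_vertices t p m"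
  using torus_edgesD[OF assms] by (auto simp: torus_left_def torus_right_def torus_vertices_def)

lemma torus_ends_orthogonal:
  assumes "q \<in> torus_edges t p m" "2 * t \<le> d"
  shows "inner_d d (torus_left t p q) (torus_right t p q) = 0"
  using torus_edgesD(3)[OF assms(1)] assms(2)
  by (simp add: torus_left_def torus_right_def inner_torus_point)

lemma torus_vertices_in_sphere:
  assumes "2 * t \<le> d" "p > 0"
  shows "torus_vertices t p m \<subseteq> unit_sphere d"
  using assms torus_point_in_sphere by (auto simp: torus_vertices_def)

lemma torus_ends_distinct:
  assumes "q \<in> torus_edges t p m" "p > 0"
  shows "torus_left t p q \<noteq> torus_right t p q"
proof
  assume eq: "torus_left t p q = torus_right t p q"
  have "torus_left t p q \<in> unit_sphere (2 * t)"
    using torus_ends_in_vertices[OF assms(1)] torus_vertices_in_sphere[OF order_refl \<open>p > 0\<close>]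
    by blast
  then show False
    using torus_ends_orthogonal[OF assms(1) order_refl] eq by (simp add: unit_sphere_def)
qed

lemma card_filter_Times_le:
  assumes "finite A" "finite B" "\<And>a. a \<in> A \<Longrightarrow> card {b\<in>B. P a b} \<le> n"
  shows "card {q\<in>A \<times> B. P (fst q) (snd q)} \<le> card A * n"
proof -
  have "{q\<in>A \<times> B. P (fst q) (snd q)} = (SIGMA a:A. {b\<in>B. P a b})" by auto
  then have "card {q\<in>A \<times> B. P (fst q) (snd q)} = (\<Sum>a\<in>A. card {b\<in>B. P a b})"
    using assms by simp
  also have "\<dots> \<le> card A * n"
    using sum_bounded_above[of A "\<lambda>a. card {b\<in>B. P a b}" n] assms by simp
  finally show ?thesis .
qed

lemma torus_degree_le:
  assumes "p > 0"
  shows "card {q \<in> torus_edges t p m. torus_left t p q = u \<or> torus_right t p q = u}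
    \<le> card (orthogonal_pairs t p) * (2 * m ^ (t - p))"
  unfolding torus_edges_def torus_left_def torus_right_def
proof (rule card_filter_Times_le[OF finite_orthogonal_pairs finite_angles])
  fix e assume "e \<in> orthogonal_pairs t p"
  then have e: "fst e \<in> words t p" "snd e \<in> words t p" by (auto simp: orthogonal_pairs_def)
  have fibre: "card {\<theta> \<in> angles t m. torus_point t p x \<theta> = u} \<le> m ^ (t - p)"
    if "x \<in> words t p" for x
    using card_torus_fibre_le[of "{x}" t p m "\<lambda>_. u"] that assms by (simp add: words_def)
  have "{\<theta> \<in> angles t m. torus_point t p (fst e) \<theta> = u \<or> torus_point t p (snd e) \<theta> = u}
      = {\<theta> \<in> angles t m. torus_point t p (fst e) \<theta> = u}
        \<union> {\<theta> \<in> angles t m. torus_point t p (snd e) \<theta> = u}"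
    by auto
  then show "card {\<theta> \<in> angles t m. torus_point t p (fst e) \<theta> = u \<or> torus_point t p (snd e) \<theta> = u}
      \<le> 2 * m ^ (t - p)"
    using fibre[OF e(1)] fibre[OF e(2)] by (auto intro: order_trans[OF card_Un_le])
qed

text \<open>
  The supports of both ends together have more than \<open>p\<close> elements, which gains a factor \<open>m\<close>
  over the bound for a single end.
\<close>

lemma torus_multiplicity_le:
  assumes "p > 0" "m > 0"
  shows "card {q \<in> torus_edges t p m. torus_left t p q = u \<and> torus_right t p q = v}
    \<le> card (orthogonal_pairs t p) * m ^ (t - p - 1)"
  unfolding torus_edges_def torus_left_def torus_right_def
proof (rule card_filter_Times_le[OF finite_orthogonal_pairs finite_angles])
  fix e assume "e \<in> orthogonal_pairs t p"
  then obtain x y where e: "e = (x, y)" and x: "x \<in> words t p" and y: "y \<in> words t p"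
      and supp: "word_supp t x \<noteq> word_supp t y"
    by (auto simp: orthogonal_pairs_def)
  have "x \<noteq> y" using supp by blast
  have "word_supp t x \<subset> word_supp t x \<union> word_supp t y"
    using supp x y card_subset_eq[OF finite_word_supp, of "word_supp t y" t x]
    by (auto simp: words_def)
  then have "p < card (word_supp t x \<union> word_supp t y)"
    using psubset_card_mono[of "word_supp t x \<union> word_supp t y" "word_supp t x"] x finite_word_supp
    by (auto simp: words_def)
  have "card {\<theta> \<in> angles t m. torus_point t p x \<theta> = u \<and> torus_point t p y \<theta> = v}
      \<le> m ^ (t - card (word_supp t x \<union> word_supp t y))"
    using card_torus_fibre_le[of "{x, y}" t p m "\<lambda>z. if z = x then u else v"] x y \<open>p > 0\<close> \<open>x \<noteq> y\<close>
    by simp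
  also have "\<dots> \<le> m ^ (t - p - 1)"
    using \<open>m > 0\<close> \<open>p < card _\<close> by (intro power_increasing) auto
  finally show "card {\<theta> \<in> angles t m. torus_point t p (fst e) \<theta> = u \<and> torus_point t p (snd e) \<theta> = v}
      \<le> m ^ (t - p - 1)"
    by (simp add: e)
qed

lemma torus_monochromatic:
  assumes p: "prime p" "odd p" and large: "8 * k * card (monomials t (p - 1)) < card (words t p)"
    and c: "c ` torus_vertices t p m \<subseteq> {..<k}"
  shows "card (torus_edges t p m) \<le> card (orthogonal_pairs t p) *
    card {q \<in> torus_edges t p m. c (torus_left t p q) = c (torus_right t p q)}"
proof -
  have "\<exists>e\<in>orthogonal_pairs t p. c (torus_left t p (e, \<theta>)) = c (torus_right t p (e, \<theta>))"
    if "\<theta> \<in> angles t m" for \<theta>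
  proof -
    have "(\<lambda>x. c (torus_point t p x \<theta>)) ` words t p \<subseteq> {..<k}"
      using c that by (auto simp: torus_vertices_def)
    from monochromatic_orthogonal_words[OF p this large] show ?thesis
      by (force simp: orthogonal_pairs_def torus_left_def torus_right_def)
  qed
  then obtain e where e: "\<And>\<theta>. \<theta> \<in> angles t m \<Longrightarrow> e \<theta> \<in> orthogonal_pairs t p \<and>
      c (torus_left t p (e \<theta>, \<theta>)) = c (torus_right t p (e \<theta>, \<theta>))"
    by metis
  have "card (angles t m)
      \<le> card {q \<in> torus_edges t p m. c (torus_left t p q) = c (torus_right t p q)}"
    using e finite_torus_edges
    by (intro card_inj_on_le[of "\<lambda>\<theta>. (e \<theta>, \<theta>)"]) (auto simp: inj_on_def torus_edges_def)
  then show ?thesis by (simp add: card_torus_edges card_angles)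
qed

lemma edge_family_torus:
  assumes p: "prime p" "odd p" and "0 < m" and "orthogonal_pairs t p \<noteq> {}"
    and large: "8 * k * card (monomials t (p - 1)) < card (words t p)"
  shows "edge_family (torus_vertices t p m) (torus_edges t p m) (torus_left t p) (torus_right t p) k
    (card (orthogonal_pairs t p)) (card (orthogonal_pairs t p) * (2 * m ^ (t - p)))
    (card (orthogonal_pairs t p) * m ^ (t - p - 1))"
proof
  have "p > 0" using p(1) by (rule prime_gt_0_nat)
  show "torus_edges t p m \<noteq> {}"
    using assms(4) \<open>0 < m\<close> card_angles[of t m] by (auto simp: torus_edges_def)
  show "torus_left t p q \<in> torus_vertices t p m \<and> torus_right t p q \<in> torus_vertices t p m \<and>
      torus_left t p q \<noteq> torus_right t p q" if "q \<in> torus_edges t p m" for q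
    using that torus_ends_in_vertices torus_ends_distinct \<open>p > 0\<close> by blast
  show "card {q \<in> torus_edges t p m. torus_left t p q = u \<or> torus_right t p q = u}
      \<le> card (orthogonal_pairs t p) * (2 * m ^ (t - p))" for u
    using \<open>p > 0\<close> by (rule torus_degree_le)
  show "card {q \<in> torus_edges t p m. torus_left t p q = u \<and> torus_right t p q = v}
      \<le> card (orthogonal_pairs t p) * m ^ (t - p - 1)" for u v
    using \<open>p > 0\<close> \<open>0 < m\<close> by (rule torus_multiplicity_le)
qed (use p large in \<open>auto intro: finite_torus_vertices finite_torus_edges torus_monochromatic\<close>)

lemma card_torus_vertices_mult_degree_le:
  assumes "p < t"
  shows "card (torus_vertices t p m) * (card (orthogonal_pairs t p) * (2 * m ^ (t - p)))
    \<le> 2 * card (words t p) * card (torus_edges t p m)"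
proof -
  let ?w = "card (words t p)" and ?h = "card (orthogonal_pairs t p)"
  have "card (torus_vertices t p m) * (?h * (2 * m ^ (t - p)))
      \<le> ?w * m ^ p * (?h * (2 * m ^ (t - p)))"
    using card_torus_vertices_le by (rule mult_right_mono) simp
  also have "\<dots> = 2 * ?w * (?h * (m ^ p * m ^ (t - p)))" by (simp add: ac_simps)
  also have "m ^ p * m ^ (t - p) = m ^ t" using assms by (simp flip: power_add)
  finally show ?thesis by (simp add: card_torus_edges)
qed

lemma card_torus_vertices_mult_multiplicity_le:
  assumes "p < t"
  shows "m * (card (torus_vertices t p m) * (card (orthogonal_pairs t p) * m ^ (t - p - 1)))
    \<le> card (words t p) * card (torus_edges t p m)"
proof -
  let ?w = "card (words t p)" and ?h = "card (orthogonal_pairs t p)"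
  have "m * (card (torus_vertices t p m) * (?h * m ^ (t - p - 1)))
      \<le> m * (?w * m ^ p * (?h * m ^ (t - p - 1)))"
    using card_torus_vertices_le by (intro mult_left_mono mult_right_mono) auto
  also have "\<dots> = ?w * (?h * (m * (m ^ p * m ^ (t - p - 1))))" by (simp add: ac_simps)
  also have "m * (m ^ p * m ^ (t - p - 1)) = m ^ t"
    using assms by (simp flip: power_add power_Suc)
  finally show ?thesis by (simp add: card_torus_edges)
qed

lemma exists_orthogonality_graph_if_many_words:
  assumes p: "prime p" "odd p" "p < t" and d: "2 * t \<le> d" and "0 < k"
    and large: "8 * k * card (monomials t (p - 1)) < card (words t p)"
  shows "\<exists>V E. high_girth_orthogonality_graph g d V E \<and> k < chromatic_number V E"
proof -
  define w h where "w = card (words t p)" and "h = card (orthogonal_pairs t p)"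
  have "p > 0" using p(1) by (rule prime_gt_0_nat)
  have "orthogonal_pairs t p \<noteq> {}"
    using monochromatic_orthogonal_words[OF p(1,2) _ large, of "\<lambda>_. 0"] \<open>0 < k\<close>
    by (auto simp: orthogonal_pairs_def)
  then have "0 < h" by (simp add: h_def card_gt_0_iff finite_orthogonal_pairs)
  from exists_high_girth_orthogonality_graph[OF this, of k "2 * w" g] obtain B where
    B: "\<And>S (Q :: torus_edge set) l r D M d. edge_family S Q l r k h D M \<Longrightarrow>
      card S * D \<le> 2 * w * card Q \<Longrightarrow> B * (card S * M) \<le> card Q \<Longrightarrow>
      S \<subseteq> unit_sphere d \<Longrightarrow> (\<And>q. q \<in> Q \<Longrightarrow> inner_d d (l q) (r q) = 0) \<Longrightarrow>
      \<exists>V E. high_girth_orthogonality_graph g d V E \<and> k < chromatic_number V E"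
    by blast
  define m where "m = B * w + 1"
  show ?thesis
  proof (rule B)
    show "edge_family (torus_vertices t p m) (torus_edges t p m) (torus_left t p) (torus_right t p)
        k h (h * (2 * m ^ (t - p))) (h * m ^ (t - p - 1))"
      unfolding h_def using p large \<open>orthogonal_pairs t p \<noteq> {}\<close>
      by (intro edge_family_torus) (auto simp: m_def)
    show "card (torus_vertices t p m) * (h * (2 * m ^ (t - p))) \<le> 2 * w * card (torus_edges t p m)"
      unfolding w_def h_def using p(3) by (rule card_torus_vertices_mult_degree_le)
    let ?M = "card (torus_vertices t p m) * (h * m ^ (t - p - 1))"
    have "m * (B * ?M) = B * (m * ?M)" by (rule mult.left_commute)
    also have "\<dots> \<le> B * (w * card (torus_edges t p m))"
      unfolding w_def h_def
      by (intro mult_left_mono card_torus_vertices_mult_multiplicity_le p(3)) simp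
    also have "\<dots> \<le> m * card (torus_edges t p m)" by (simp add: m_def)
    finally show "B * ?M \<le> card (torus_edges t p m)"
      by (simp only: mult_le_cancel1) (simp add: m_def)
    show "torus_vertices t p m \<subseteq> unit_sphere d"
      using d \<open>p > 0\<close> by (rule torus_vertices_in_sphere)
    show "inner_d d (torus_left t p q) (torus_right t p q) = 0" if "q \<in> torus_edges t p m" for q
      using that d by (rule torus_ends_orthogonal)
  qed
qed

lemma eventually_exists_orthogonality_graph:
  "\<forall>\<^sub>F d in sequentially. \<forall>g. \<exists>V E. high_girth_orthogonality_graph g d V E \<and>
     1.074 ^ d \<le> real (chromatic_number V E)"
proof -
  have "filterlim (\<lambda>d::nat. d div 2) sequentially sequentially"
    unfolding filterlim_at_top
  proof
    fix n :: nat
    show "\<forall>\<^sub>F d in sequentially. n \<le> d div 2"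
      using eventually_ge_at_top[of "2 * n"] by eventually_elim simp
  qed
  from filterlim_iff[THEN iffD1, rule_format, OF this eventually_many_words] show ?thesis
  proof eventually_elim
    case (elim d)
    define t where "t = d div 2"
    have t: "2 * t \<le> d" "d \<le> 2 * t + 1" by (auto simp: t_def)
    define k where "k = nat \<lfloor>(1.074::real) ^ d\<rfloor>"
    have "(1::real) \<le> 1.074 ^ d" by (rule one_le_power) simp
    then have k: "0 < k" "real k \<le> 1.074 ^ d" "1.074 ^ d < real k + 1"
      unfolding k_def by linarith+
    have "real k \<le> 1.074 ^ (2 * t + 1)"
      using k(2) power_increasing[OF t(2), of "1.074::real"] by simp
    then obtain p where p: "prime p" "odd p" "p < t"
        "8 * k * card (monomials t (p - 1)) < card (words t p)"
      using elim unfolding t_def by blast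
    show ?case
    proof
      fix g
      obtain V E where VE: "high_girth_orthogonality_graph g d V E" "k < chromatic_number V E"
        using exists_orthogonality_graph_if_many_words[OF p(1-3) t(1) k(1) p(4)] by blast
      then have "1.074 ^ d \<le> real (chromatic_number V E)" using k(3) by linarith
      then show "\<exists>V E. high_girth_orthogonality_graph g d V E \<and>
          1.074 ^ d \<le> real (chromatic_number V E)"
        using VE(1) by blast
    qed
  qed
qed

theorem theorem1p3:
  shows "\<exists>\<epsilon> :: nat \<Rightarrow> real. \<epsilon> \<longlonglongrightarrow> 0 \<and>
    (\<forall>g d :: nat. g \<ge> 3 \<longrightarrow> d > 0 \<longrightarrow>
      (\<exists>V E. finite V \<and> simple_graph V E \<and>
         orthogonality_graph_in d (unit_sphere d) V E \<and>
         girth_at_least g V E \<and>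
         real (chromatic_number V E) \<ge> (1.074 + \<epsilon> d) ^ d))"
proof -
  obtain d0 where large: "\<And>g d. d0 \<le> d \<Longrightarrow>
      \<exists>V E. high_girth_orthogonality_graph g d V E \<and> 1.074 ^ d \<le> real (chromatic_number V E)"
    using eventually_exists_orthogonality_graph unfolding eventually_sequentially by blast
  define \<epsilon> :: "nat \<Rightarrow> real" where "\<epsilon> d = (if d < d0 then - 0.074 else 0)" for d
  have "\<epsilon> \<longlonglongrightarrow> 0"
    by (rule tendsto_eventually) (auto simp: \<epsilon>_def intro: eventually_sequentiallyI[of d0])
  moreover have "\<exists>V E. high_girth_orthogonality_graph g d V E \<and>
      (1.074 + \<epsilon> d) ^ d \<le> real (chromatic_number V E)"
    if "d > 0" for g d
  proof (cases "d < d0")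
    case True
    have "0 < chromatic_number {0} {}"
      by (rule less_chromatic_number) (auto simp: simple_graph_def proper_colouring_def)
    then show ?thesis
      using True high_girth_orthogonality_graph_singleton[OF that]
      by (intro exI[of _ "{0}"] exI[of _ "{}"]) (simp add: \<epsilon>_def)
  next
    case False
    then show ?thesis using large[of d g] by (simp add: \<epsilon>_def)
  qed
  ultimately show ?thesis
    unfolding high_girth_orthogonality_graph_def by (intro exI[of _ \<epsilon>]) (simp add: conj_assoc)
qed

end
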